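(* Let $D$ be a 2-strong digraph of order $n\geq 6$ such that $d(x)+d(y)+d(w)+d(z)\geq 4n-3$ for all distinct pairs $\{x,y\}\neq\{w,z\}$ of non-adjacent vertices of $D$. Suppose that $D$ contains a pair of non-adjacent vertices $x,y$ with $d(x)+d(y)\leq 2n-4$. Then $D$ is pancyclic, i.e. $D$ contains directed cycles of every length $m$ with $3\leq m\leq n$.
   Context: Digraphs are finite, without loops and multiple arcs. For a vertex $x$, $d(x)=d^+(x)+d^-(x)$ is the sum of its out-degree and in-degree. Two distinct vertices $x,y$ are adjacent if $xy\in A(D)$ or $yx\in A(D)$. A digraph is 2-strong if it has at least 3 vertices and remains strongly connected after deleting any single vertex. The length of a cycle is its number of arcs. *)

theory Defs
  imports "Graph_Theory.Graph_Theory"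
begin

definition total_degree :: "('a, 'b) pre_digraph \<Rightarrow> 'a \<Rightarrow> nat" where
  "total_degree D x = out_degree D x + in_degree D x"

definition adjacent :: "('a, 'b) pre_digraph \<Rightarrow> 'a \<Rightarrow> 'a \<Rightarrow> bool" where
  "adjacent D x y \<longleftrightarrow> x \<rightarrow>\<^bsub>D\<^esub> y \<or> y \<rightarrow>\<^bsub>D\<^esub> x"

definition nonadjacent_pair :: "('a, 'b) pre_digraph \<Rightarrow> 'a \<Rightarrow> 'a \<Rightarrow> bool" where
  "nonadjacent_pair D x y \<longleftrightarrow> x \<in> verts D \<and> y \<in> verts D \<and> x \<noteq> y \<and> \<not> adjacent D x y"

definition two_strong :: "('a, 'b) pre_digraph \<Rightarrow> bool" where
  "two_strong D \<longleftrightarrow> card (verts D) \<ge> 3 \<and> strongly_connected D \<and>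
     (\<forall>v \<in> verts D. strongly_connected (pre_digraph.del_vert D v))"

(* Cycles are lists of arcs, so the length of the list is the length of the cycle. *)
definition pancyclic :: "('a, 'b) pre_digraph \<Rightarrow> bool" where
  "pancyclic D \<longleftrightarrow>
     (\<forall>m. 3 \<le> m \<and> m \<le> card (verts D) \<longrightarrow> (\<exists>p. pre_digraph.cycle D p \<and> length p = m))"

end

theory Submission
  imports Defs
begin

text \<open>
  Let \<open>x, y\<close> be the given non-adjacent pair; every other non-adjacent pair has degree sum at least
  \<open>2n + 1\<close>.

  A cycle through both \<open>x\<close> and \<open>y\<close> can be enlarged to a Hamiltonian cycle by the argument of
  Bondy and Thomassen for Meyniel's theorem: a cycle that cannot be enlarged yields a vertex off it
  and a non-adjacent vertex on it with degree sum at most \<open>2n - 2\<close>.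

  Suppose that no cycle contains \<open>x\<close> and \<open>y\<close>. Then any arc \<open>z \<rightarrow> v\<close> from an out-neighbour of \<open>y\<close>
  to an in-neighbour of \<open>x\<close> separates \<open>x\<close> from \<open>y\<close>. If some \<open>v\<close> had three such \<open>z\<close>, the
  degree condition would produce another such arc for which the set reachable from \<open>x\<close> is strictly
  larger, and so on forever. Hence there are at most two, and the degree condition now
  makes every out-neighbour of \<open>x\<close> or \<open>y\<close> easily reachable from both of them, and dually for
  in-neighbours. Menger's theorem gives two disjoint paths from the out-neighbours to the
  in-neighbours, and these can be closed to a cycle through \<open>x\<close> and \<open>y\<close> after all.

  For the shorter cycles, either \<open>x, y\<close> is the only non-adjacent pair and \<open>D - x\<close> is a strong
  semicomplete digraph, or some vertex \<open>v\<close> has degree at least \<open>n + 1\<close>. In the latter case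
  \<open>D - v\<close> has a cycle missing at most one vertex, and \<open>v\<close> forms cycles of all lengths with
  segments of it.
\<close>

subsection \<open>Walks, cycles and degrees in relations\<close>

text \<open>Walks, cycles and degrees are taken over a plain arc relation, so that reversing all
  arcs is \<open>E\<inverse>\<close> and dual statements follow from the \<open>_rev\<close> and
  \<open>_converse\<close> lemmas.\<close>

definition is_walk :: "('a \<times> 'a) set \<Rightarrow> 'a list \<Rightarrow> bool" where
  "is_walk E xs \<longleftrightarrow> xs \<noteq> [] \<and> successively (\<lambda>a b. (a, b) \<in> E) xs"

definition is_cycle :: "('a \<times> 'a) set \<Rightarrow> 'a list \<Rightarrow> bool" where
  "is_cycle E xs \<longleftrightarrow> is_walk E xs \<and> distinct xs \<and> 2 \<le> length xs \<and> (last xs, hd xs) \<in> E"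

text \<open>Opposite arcs count twice. The set \<open>A\<close> varies so that a degree can be split
  over a cycle and its complement.\<close>

definition deg_into :: "('a \<times> 'a) set \<Rightarrow> 'a set \<Rightarrow> 'a \<Rightarrow> nat" where
  "deg_into E A w = card {u \<in> A. (w, u) \<in> E} + card {u \<in> A. (u, w) \<in> E}"

definition strong_on :: "('a \<times> 'a) set \<Rightarrow> 'a set \<Rightarrow> bool" where
  "strong_on E A \<longleftrightarrow> (\<forall>a\<in>A. \<forall>b\<in>A. (a, b) \<in> (Restr E A)\<^sup>*)"

definition nonadj :: "('a \<times> 'a) set \<Rightarrow> 'a \<Rightarrow> 'a \<Rightarrow> bool" where
  "nonadj E u v \<longleftrightarrow> u \<noteq> v \<and> (u, v) \<notin> E \<and> (v, u) \<notin> E"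

lemma length_ge_4:
  assumes "4 \<le> length xs"
  obtains a b c d r where "xs = a # b # c # d # r"
  using assms by (auto simp: Suc_le_length_iff numeral_eq_Suc)

lemma is_walk_append:
  "xs \<noteq> [] \<Longrightarrow> ys \<noteq> [] \<Longrightarrow>
    is_walk E (xs @ ys) \<longleftrightarrow> is_walk E xs \<and> is_walk E ys \<and> (last xs, hd ys) \<in> E"
  by (auto simp: is_walk_def successively_append_iff)

lemma is_walk_Cons:
  "is_walk E (x # xs) \<longleftrightarrow> xs = [] \<or> (x, hd xs) \<in> E \<and> is_walk E xs"
  by (auto simp: is_walk_def successively_Cons)

lemma is_walk_single [simp]: "is_walk E [x]"
  by (simp add: is_walk_def)

lemma is_walk_appendD1: "is_walk E (xs @ ys) \<Longrightarrow> xs \<noteq> [] \<Longrightarrow> is_walk E xs"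
  by (auto simp: is_walk_def successively_append_iff)

lemma is_walk_appendD2: "is_walk E (xs @ ys) \<Longrightarrow> ys \<noteq> [] \<Longrightarrow> is_walk E ys"
  by (auto simp: is_walk_def successively_append_iff)

lemma is_walk_not_Nil: "is_walk E xs \<Longrightarrow> xs \<noteq> []"
  by (simp add: is_walk_def)

lemma is_walk_rev: "is_walk (E\<inverse>) (rev xs) \<longleftrightarrow> is_walk E xs"
  by (simp add: is_walk_def)

lemma is_cycle_rev: "is_cycle (E\<inverse>) (rev xs) \<longleftrightarrow> is_cycle E xs"
  by (auto simp: is_cycle_def is_walk_rev hd_rev last_rev)

lemma deg_into_converse: "deg_into (E\<inverse>) A w = deg_into E A w"
  by (simp add: deg_into_def)

lemma strong_on_converse: "strong_on (E\<inverse>) A \<longleftrightarrow> strong_on E A"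
proof -
  have "Restr (E\<inverse>) A = (Restr E A)\<inverse>" by auto
  then have "(Restr (E\<inverse>) A)\<^sup>* = ((Restr E A)\<^sup>*)\<inverse>" by (simp only: rtrancl_converse)
  then show ?thesis unfolding strong_on_def by auto
qed

lemma nonadj_converse: "nonadj (E\<inverse>) u v \<longleftrightarrow> nonadj E u v"
  by (auto simp: nonadj_def)

lemma nonadj_sym: "nonadj E u v \<Longrightarrow> nonadj E v u"
  by (auto simp: nonadj_def)

lemma is_cycle_rotate:
  assumes "is_cycle E (xs @ ys)" shows "is_cycle E (ys @ xs)"
  using assms by (cases "xs = []"; cases "ys = []") (auto simp: is_cycle_def is_walk_append)

lemma is_cycle_close:
  assumes "is_walk E P" "is_walk E Q" "distinct P" "distinct Q" "set P \<inter> set Q = {}"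
    "(last P, hd Q) \<in> E" "(last Q, hd P) \<in> E"
  shows "is_cycle E (P @ Q)"
proof -
  have ne: "P \<noteq> []" "Q \<noteq> []" using assms is_walk_not_Nil by blast+
  then have "2 \<le> length (P @ Q)" by (cases P; cases Q) auto
  with assms ne show ?thesis by (auto simp: is_cycle_def is_walk_append)
qed

lemma rtrancl_imp_path:
  assumes "(a, b) \<in> (Restr E A)\<^sup>*" "a \<in> A"
  obtains xs where "is_walk E xs" "distinct xs" "hd xs = a" "last xs = b" "set xs \<subseteq> A"
proof -
  from assms have "\<exists>xs. is_walk E xs \<and> distinct xs \<and> hd xs = a \<and> last xs = b \<and> set xs \<subseteq> A"
  proof (induction rule: rtrancl_induct)
    case base
    then show ?case by (intro exI[of _ "[a]"]) simp
  next
    case (step y z)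
    then obtain xs where xs: "is_walk E xs" "distinct xs" "hd xs = a" "last xs = y" "set xs \<subseteq> A"
      by blast
    show ?case
    proof (cases "z \<in> set xs")
      case False
      with xs step show ?thesis
        by (intro exI[of _ "xs @ [z]"]) (auto simp: is_walk_append is_walk_not_Nil)
    next
      case True
      \<comment> \<open>If \<open>z\<close> was visited before, the path is cut there, which keeps
        it distinct.\<close>
      then obtain us vs where "xs = us @ z # vs" by (meson split_list)
      then have e: "xs = (us @ [z]) @ vs" by simp
      with xs(1) have "is_walk E ((us @ [z]) @ vs)" by simp
      then have "is_walk E (us @ [z])" by (rule is_walk_appendD1) simp
      moreover have "hd (us @ [z]) = a" using e xs(3) by (cases us) auto
      ultimately show ?thesis using e xs(2,5) by (intro exI[of _ "us @ [z]"]) simp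
    qed
  qed
  with that show thesis by blast
qed

lemma walk_imp_rtrancl:
  assumes "is_walk E xs" "set xs \<subseteq> A"
  shows "(hd xs, last xs) \<in> (Restr E A)\<^sup>*"
  using assms
proof (induction xs)
  case Nil
  then show ?case by (simp add: is_walk_def)
next
  case (Cons x xs)
  then have "xs = [] \<or> (x, hd xs) \<in> Restr E A \<and> (hd xs, last xs) \<in> (Restr E A)\<^sup>*"
    by (cases xs) (auto simp: is_walk_Cons)
  then show ?case by (auto intro: converse_rtrancl_into_rtrancl)
qed

lemma strong_on_path:
  assumes "strong_on E A" "a \<in> A" "b \<in> A"
  obtains xs where "is_walk E xs" "distinct xs" "hd xs = a" "last xs = b" "set xs \<subseteq> A"
  using assms rtrancl_imp_path[of a b E A thesis] unfolding strong_on_def by blast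

text \<open>Take the first arc \<open>a -> c\<close> of a path to \<open>b\<close>; a path from
  \<open>c\<close> back to \<open>a\<close> closes it up.\<close>

lemma strong_on_ex_cycle:
  assumes "strong_on E A" "a \<in> A" "b \<in> A" "a \<noteq> b"
  obtains C where "is_cycle E C" "set C \<subseteq> A"
proof -
  obtain xs where xs: "is_walk E xs" "distinct xs" "hd xs = a" "last xs = b" "set xs \<subseteq> A"
    using strong_on_path assms by metis
  then obtain c ys where ys: "xs = a # c # ys" using \<open>a \<noteq> b\<close>
    by (metis is_walk_not_Nil last_ConsL list.collapse)
  then have ac: "(a, c) \<in> E" "c \<in> A" "a \<noteq> c" using xs by (auto simp: is_walk_Cons)
  obtain zs where zs: "is_walk E zs" "distinct zs" "hd zs = c" "last zs = a" "set zs \<subseteq> A"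
    using strong_on_path assms ac by metis
  have "2 \<le> length zs" using zs ac is_walk_not_Nil[OF zs(1)] by (cases zs; cases "tl zs") auto
  with zs ac have "is_cycle E zs" by (auto simp: is_cycle_def)
  with zs that show thesis by blast
qed

section \<open>Counting degrees into vertex sets\<close>

lemma deg_into_Un:
  assumes "finite A" "finite B" "A \<inter> B = {}"
  shows "deg_into E (A \<union> B) w = deg_into E A w + deg_into E B w"
proof -
  have "card {u \<in> A \<union> B. P u} = card {u \<in> A. P u} + card {u \<in> B. P u}" for P
  proof -
    have "{u \<in> A \<union> B. P u} = {u \<in> A. P u} \<union> {u \<in> B. P u}" by auto
    then show ?thesis using assms by (simp add: card_Un_disjoint disjoint_iff)
  qed
  then show ?thesis by (simp add: deg_into_def)
qed

lemma deg_into_split: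
  assumes "finite A" "B \<subseteq> A"
  shows "deg_into E A w = deg_into E B w + deg_into E (A - B) w"
proof -
  have "A = B \<union> (A - B)" using assms by auto
  moreover have "finite B" using assms finite_subset by blast
  ultimately show ?thesis using deg_into_Un[of B "A - B" E w] assms by simp
qed

lemma deg_into_le:
  assumes "finite A"
  shows "deg_into E A w \<le> 2 * card A"
proof -
  have "card {u \<in> A. P u} \<le> card A" for P using assms by (auto intro: card_mono)
  from this[of "\<lambda>u. (w, u) \<in> E"] this[of "\<lambda>u. (u, w) \<in> E"] show ?thesis
    by (simp add: deg_into_def)
qed

lemma deg_into_le_self:
  assumes "finite A" "irrefl E" "w \<in> A"
  shows "deg_into E A w \<le> 2 * (card A - 1)"
proof -
  have "deg_into E A w = deg_into E {w} w + deg_into E (A - {w}) w"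
    using assms by (intro deg_into_split) auto
  also have "deg_into E {w} w = 0" using assms by (auto simp: deg_into_def irrefl_def)
  finally show ?thesis using deg_into_le[of "A - {w}" E w] assms by simp
qed

lemma deg_into_mono: "finite B \<Longrightarrow> A \<subseteq> B \<Longrightarrow> deg_into E A w \<le> deg_into E B w"
  by (simp add: deg_into_split[of B A])

lemma deg_into_eq_0: "(\<And>u. u \<in> A \<Longrightarrow> (w, u) \<notin> E \<and> (u, w) \<notin> E) \<Longrightarrow> deg_into E A w = 0"
  by (auto simp: deg_into_def card_eq_0_iff)

lemma deg_into_supp:
  assumes "B \<subseteq> A" "\<And>u. u \<in> A - B \<Longrightarrow> (w, u) \<notin> E \<and> (u, w) \<notin> E"
  shows "deg_into E A w = deg_into E B w"
proof -
  have "{u \<in> A. (w, u) \<in> E} = {u \<in> B. (w, u) \<in> E}" "{u \<in> A. (u, w) \<in> E} = {u \<in> B. (u, w) \<in> E}"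
    using assms by auto
  then show ?thesis by (simp add: deg_into_def)
qed

text \<open>Two consecutive vertices \<open>a\<close>, \<open>b\<close> of \<open>Q\<close>
  contribute at most one of the arcs \<open>a -> w\<close> and \<open>w -> b\<close>. Only
  \<open>w -> hd Q\<close> and \<open>last Q -> w\<close> remain, so the total is at most
  \<open>(length Q - 1) + 2\<close>.\<close>

lemma deg_into_no_insert:
  assumes "w \<notin> set Q" "distinct Q" "Q \<noteq> []"
    and "\<And>P R. Q = P @ R \<Longrightarrow> P \<noteq> [] \<Longrightarrow> R \<noteq> [] \<Longrightarrow> \<not> ((last P, w) \<in> E \<and> (w, hd R) \<in> E)"
  shows "deg_into E (set Q) w \<le> length Q + 1"
proof -
  \<comment> \<open>The bound records whether \<open>w -> hd Q\<close> holds, because this arc and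
    an arc into \<open>w\<close> from a vertex prepended to \<open>Q\<close> exclude each
    other.\<close>
  have "deg_into E (set Q) w \<le> length Q + (if (w, hd Q) \<in> E then 1 else 0)"
    using assms
  proof (induction Q)
    case (Cons q Q)
    have dq: "deg_into E {q} w = (if (w, q) \<in> E then 1 else 0) + (if (q, w) \<in> E then 1 else 0)"
    proof -
      have "{u \<in> {q}. P u} = (if P q then {q} else {})" for P by auto
      then show ?thesis by (simp add: deg_into_def)
    qed
    show ?case
    proof (cases "Q = []")
      case False
      have IH: "deg_into E (set Q) w \<le> length Q + (if (w, hd Q) \<in> E then 1 else 0)"
      proof (rule Cons.IH)
        fix P R assume "Q = P @ R" "P \<noteq> []" "R \<noteq> []"
        then show "\<not> ((last P, w) \<in> E \<and> (w, hd R) \<in> E)"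
          using Cons.prems(4)[of "q # P" R] by auto
      qed (use Cons.prems False in auto)
      have nb: "\<not> ((q, w) \<in> E \<and> (w, hd Q) \<in> E)" using Cons.prems(4)[of "[q]" Q] False by auto
      have "deg_into E (set (q # Q)) w = deg_into E {q} w + deg_into E (set Q) w"
        using deg_into_Un[of "{q}" "set Q"] Cons.prems by auto
      with IH dq nb show ?thesis by (simp split: if_splits)
    qed (simp add: dq)
  qed simp
  then show ?thesis by (auto split: if_splits)
qed

text \<open>Pigeonhole on the pairs of cycle vertices at distance \<open>m - 2\<close> along the cycle.\<close>
lemma cycle_all_lengths:
  assumes C: "is_cycle E C" and v: "v \<notin> set C" and d: "length C + 1 \<le> deg_into E (set C) v"
    and m: "2 \<le> m" "m \<le> length C + 1"
  shows "\<exists>C'. is_cycle E C' \<and> length C' = m"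
proof -
  define r where "r = length C"
  have dC: "distinct C" and r2: "2 \<le> r" using C by (auto simp: is_cycle_def r_def)
  \<comment> \<open>A cycle of length \<open>m\<close> through \<open>v\<close> uses
    \<open>m - 1\<close> consecutive vertices of \<open>C\<close>, from index \<open>i\<close> to
    index \<open>f i\<close>.\<close>
  define f where "f i = (i + (m - 2)) mod r" for i
  define S where "S = {i. i < r \<and> (v, C ! i) \<in> E}"
  define T where "T = {i. i < r \<and> (C ! f i, v) \<in> E}"
  have cardset: "card {i. i < r \<and> P (C ! i)} = card {u \<in> set C. P u}" for P
  proof -
    have "bij_betw ((!) C) {i. i < r \<and> P (C ! i)} {u \<in> set C. P u}"
      using dC by (auto simp: bij_betw_def inj_on_def r_def nth_eq_iff_index_eq in_set_conv_nth)
    then show ?thesis by (rule bij_betw_same_card)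
  qed
  have injf: "inj_on f {..<r}"
  proof (rule inj_onI)
    fix i j assume ij: "i \<in> {..<r}" "j \<in> {..<r}" "f i = f j"
    have key: "a = b" if "a \<le> b" "b < r" "(b + k) mod r = (a + k) mod r" for a b k
    proof -
      have "r dvd (b + k) - (a + k)" using that mod_eq_dvd_iff_nat[of "a + k" "b + k" r] by simp
      then have "r dvd b - a" by simp
      then show ?thesis using that by (cases "a = b") (auto dest!: dvd_imp_le)
    qed
    show "i = j" using ij key[of i j "m - 2"] key[of j i "m - 2"] by (cases "i \<le> j") (auto simp: f_def)
  qed
  have fr: "f i < r" for i using r2 by (simp add: f_def)
  have surjf: "f ` {..<r} = {..<r}"
    using injf fr by (intro card_subset_eq) (auto simp: card_image)
  have cT: "card T = card {i. i < r \<and> (C ! i, v) \<in> E}"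
  proof -
    have "f ` T = {i. i < r \<and> (C ! i, v) \<in> E}"
    proof
      show "{i. i < r \<and> (C ! i, v) \<in> E} \<subseteq> f ` T"
      proof
        fix i assume i: "i \<in> {i. i < r \<and> (C ! i, v) \<in> E}"
        then have "i \<in> f ` {..<r}" using surjf by auto
        with i show "i \<in> f ` T" by (auto simp: T_def)
      qed
    qed (use fr in \<open>auto simp: T_def\<close>)
    moreover have "card (f ` T) = card T"
      using injf by (intro card_image) (auto simp: T_def inj_on_def)
    ultimately show ?thesis by simp
  qed
  \<comment> \<open>As \<open>f\<close> permutes the indices, \<open>card T\<close> is the number of
    in-neighbours of \<open>v\<close> on \<open>C\<close>; the two sets are too large to be disjoint
    among \<open>r\<close> indices.\<close>
  have "card S + card T \<ge> r + 1"
    using d cT cardset[of "\<lambda>u. (v, u) \<in> E"] cardset[of "\<lambda>u. (u, v) \<in> E"]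
    by (simp add: S_def deg_into_def r_def)
  moreover have "card (S \<union> T) \<le> card {..<r}" by (intro card_mono) (auto simp: S_def T_def)
  moreover have "finite S" "finite T" by (auto simp: S_def T_def)
  ultimately have "S \<inter> T \<noteq> {}" using card_Un_Int[of S T] by auto
  then obtain i where i: "i < r" "(v, C ! i) \<in> E" "(C ! f i, v) \<in> E" by (auto simp: S_def T_def)
  \<comment> \<open>Since \<open>m - 1\<close> is at most \<open>r\<close>, this segment does not
    wrap onto itself.\<close>
  define K where "K = take (m - 1) (rotate i C)"
  have rot: "is_cycle E (rotate i C)"
    using is_cycle_rotate[of E "take i C" "drop i C"] C i by (simp add: rotate_drop_take r_def)
  have Kne: "K \<noteq> []" using m r2 by (auto simp: K_def r_def)
  have "is_walk E (take (m - 1) (rotate i C) @ drop (m - 1) (rotate i C))"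
    using rot by (simp add: is_cycle_def)
  then have wK: "is_walk E K" using Kne is_walk_appendD1 unfolding K_def by blast
  have hdK: "hd K = C ! i" using Kne i by (simp add: K_def hd_rotate_conv_nth r_def hd_conv_nth nth_rotate)
  have lenK: "length K = m - 1" using m by (simp add: K_def r_def)
  have lastK: "last K = C ! f i"
  proof -
    have "last K = K ! (m - 2)" using Kne lenK m by (simp add: last_conv_nth numeral_2_eq_2)
    also have "\<dots> = rotate i C ! (m - 2)" using m by (simp add: K_def)
    also have "\<dots> = C ! f i" using m r2 by (simp add: nth_rotate f_def r_def)
    finally show ?thesis .
  qed
  have "set K \<subseteq> set C" "distinct K"
    using dC set_take_subset[of "m - 1" "rotate i C"] by (auto simp: K_def)
  then have "is_cycle E ([v] @ K)"
    using wK hdK lastK i v by (intro is_cycle_close) auto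
  with lenK m show ?thesis by (intro exI[of _ "[v] @ K"]) simp
qed

subsection \<open>Enlarging cycles\<close>

lemma card_add_le:
  assumes "finite W" "S \<subseteq> W" "T \<subseteq> W"
  shows "card S + card T \<le> card W + card (S \<inter> T)"
proof -
  have "finite S" "finite T" using assms finite_subset by blast+
  moreover have "card (S \<union> T) \<le> card W" using assms by (intro card_mono) auto
  ultimately show ?thesis using card_Un_Int[of S T] by simp
qed

text \<open>Out-neighbours of \<open>w\<close> and in-neighbours of \<open>u\<close> are disjoint
  within \<open>W - {w}\<close>; in-neighbours of \<open>w\<close> and out-neighbours of
  \<open>u\<close> there share at most \<open>x\<close>. Each of the two pairs of sets is counted
  within \<open>W - {w}\<close>.\<close>

lemma off_cycle_degree_sum:
  assumes W: "finite W" "w \<in> W" and irr: "irrefl E" and "(u, w) \<notin> E" "(w, u) \<notin> E"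
    and o: "\<And>z. z \<in> W \<Longrightarrow> \<not> ((w, z) \<in> E \<and> (z, u) \<in> E)"
    and i: "\<And>z. z \<in> W \<Longrightarrow> (u, z) \<in> E \<Longrightarrow> (z, w) \<in> E \<Longrightarrow> z = x"
  shows "deg_into E W w + deg_into E W u
    \<le> 2 * (card W - 1) + (if x \<in> W \<and> (u, x) \<in> E \<and> (x, w) \<in> E then 1 else 0)"
proof -
  have ww: "(w, w) \<notin> E" using irr by (auto simp: irrefl_def)
  let ?e = "if x \<in> W \<and> (u, x) \<in> E \<and> (x, w) \<in> E then 1 else (0::nat)"
  have "card {z \<in> W. (w, z) \<in> E} + card {z \<in> W. (z, u) \<in> E}
      \<le> card (W - {w}) + card ({z \<in> W. (w, z) \<in> E} \<inter> {z \<in> W. (z, u) \<in> E})"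
    using assms ww by (intro card_add_le) auto
  moreover have "{z \<in> W. (w, z) \<in> E} \<inter> {z \<in> W. (z, u) \<in> E} = {}" using o by auto
  moreover have "card {z \<in> W. (u, z) \<in> E} + card {z \<in> W. (z, w) \<in> E}
      \<le> card (W - {w}) + card ({z \<in> W. (u, z) \<in> E} \<inter> {z \<in> W. (z, w) \<in> E})"
    using assms ww by (intro card_add_le) auto
  moreover have "card ({z \<in> W. (u, z) \<in> E} \<inter> {z \<in> W. (z, w) \<in> E}) \<le> ?e"
  proof -
    have "{z \<in> W. (u, z) \<in> E} \<inter> {z \<in> W. (z, w) \<in> E}
        \<subseteq> (if x \<in> W \<and> (u, x) \<in> E \<and> (x, w) \<in> E then {x} else {})"
    proof
      fix z assume z: "z \<in> {z \<in> W. (u, z) \<in> E} \<inter> {z \<in> W. (z, w) \<in> E}"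
      then have "z = x" using i[of z] by blast
      with z show "z \<in> (if x \<in> W \<and> (u, x) \<in> E \<and> (x, w) \<in> E then {x} else {})" by simp
    qed
    then have "card ({z \<in> W. (u, z) \<in> E} \<inter> {z \<in> W. (z, w) \<in> E})
        \<le> card (if x \<in> W \<and> (u, x) \<in> E \<and> (x, w) \<in> E then {x} else {})"
      by (intro card_mono) auto
    then show ?thesis by (auto split: if_splits)
  qed
  moreover have "card (W - {w}) = card W - 1" using W by simp
  ultimately show ?thesis by (simp add: deg_into_def)
qed

text \<open>The vertex \<open>x\<close> is exempt from the degree condition, so a detour must not consist of \<open>x\<close>
  alone. A gap is the segment \<open>G\<close> of the cycle \<open>Q @ G\<close> which a detour from the last to the first
  vertex of \<open>Q\<close> bypasses.\<close>
definition detour ::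
  "('a \<times> 'a) set \<Rightarrow> 'a set \<Rightarrow> 'a set \<Rightarrow> 'a \<Rightarrow> 'a list \<Rightarrow> 'a \<Rightarrow> 'a \<Rightarrow> bool" where
  "detour E A C x ps a b \<longleftrightarrow> is_walk E ps \<and> distinct ps \<and> set ps \<subseteq> A - C \<and> ps \<noteq> [x] \<and>
     (a, hd ps) \<in> E \<and> (last ps, b) \<in> E"

definition gap ::
  "('a \<times> 'a) set \<Rightarrow> 'a set \<Rightarrow> 'a set \<Rightarrow> 'a \<Rightarrow> 'a list \<Rightarrow> 'a list \<Rightarrow> 'a list \<Rightarrow> bool" where
  "gap E A C x Q G ps \<longleftrightarrow> is_cycle E (Q @ G) \<and> set (Q @ G) = C \<and> Q \<noteq> [] \<and> last Q \<noteq> hd Q \<and>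
     detour E A C x ps (last Q) (hd Q)"

lemma detour_converse: "detour (E\<inverse>) A C x (rev ps) b a \<longleftrightarrow> detour E A C x ps a b"
  using is_walk_rev[of E ps]
  by (cases "ps = []") (auto simp: detour_def hd_rev last_rev is_walk_def simp del: successively_rev)

lemma gap_converse:
  assumes "gap E A C x Q G ps"
  shows "gap (E\<inverse>) A C x (rev Q) (rev G) (rev ps)"
proof -
  have "is_cycle (E\<inverse>) (rev (Q @ G))" using assms by (simp add: gap_def is_cycle_rev del: rev_append)
  then have "is_cycle (E\<inverse>) (rev Q @ rev G)" using is_cycle_rotate[of _ "rev G" "rev Q"] by simp
  then show ?thesis using assms by (auto simp: gap_def detour_converse hd_rev last_rev)
qed

text \<open>The new cycle must retain all of \<open>C\<close>, not merely be longer: a cycle through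
  \<open>x\<close> and \<open>y\<close> thus keeps both while it grows.\<close>

definition bigger_cycle :: "('a \<times> 'a) set \<Rightarrow> 'a set \<Rightarrow> 'a set \<Rightarrow> bool" where
  "bigger_cycle E A C \<longleftrightarrow> (\<exists>C'. is_cycle E C' \<and> C \<subset> set C' \<and> set C' \<subseteq> A)"

text \<open>The bound is one below Meyniel's \<open>2 * card A - 1\<close>, so such a pair
  contradicts a Meyniel condition for it.\<close>

definition light_pair :: "('a \<times> 'a) set \<Rightarrow> 'a set \<Rightarrow> 'a set \<Rightarrow> 'a \<Rightarrow> bool" where
  "light_pair E A C x \<longleftrightarrow> (\<exists>w\<in>A - C - {x}. \<exists>u\<in>C. nonadj E w u \<and>
     deg_into E A w + deg_into E A u \<le> 2 * card A - 2)"

lemma bigger_cycle_converse: "bigger_cycle (E\<inverse>) A C \<longleftrightarrow> bigger_cycle E A C"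
  unfolding bigger_cycle_def by (metis is_cycle_rev set_rev converse_converse)

lemma light_pair_converse: "light_pair (E\<inverse>) A C x \<longleftrightarrow> light_pair E A C x"
  unfolding light_pair_def by (simp add: deg_into_converse nonadj_converse)

text \<open>The vertices of a minimal gap have no connection off the cycle with \<open>w\<close>, the first vertex
  of the detour. As many of them as possible are reinserted into \<open>Q\<close>; one of the remaining ones,
  \<open>u\<close>, forms the light pair with \<open>w\<close>.\<close>
lemma minimal_gap_extends:
  assumes fin: "finite A" and irr: "irrefl E" and CA: "C \<subseteq> A" and g: "gap E A C x Q G ps"
    and hdps: "hd ps \<noteq> x"
    and min: "\<And>Q' G' ps'. gap E A C x Q' G' ps' \<Longrightarrow> length G \<le> length G'"
  shows "bigger_cycle E A C \<or> light_pair E A C x"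
proof (rule disjCI)
  assume "\<not> light_pair E A C x"
  show "bigger_cycle E A C"
  proof (rule ccontr)
    assume nb: "\<not> bigger_cycle E A C"
    have cyc: "is_cycle E (Q @ G)" and C: "C = set (Q @ G)" and Q: "Q \<noteq> []" "last Q \<noteq> hd Q"
      and ps: "is_walk E ps" "distinct ps" "set ps \<subseteq> A - C" "ps \<noteq> [x]"
        "(last Q, hd ps) \<in> E" "(last ps, hd Q) \<in> E"
      using g by (auto simp: gap_def detour_def)
    have psne: "ps \<noteq> []" using ps is_walk_not_Nil by blast
    have dQG: "distinct (Q @ G)" and wQ: "is_walk E Q"
      using cyc Q is_walk_appendD1 by (auto simp: is_cycle_def)
    have nocyc: "False" if "is_cycle E C'" "C \<subseteq> set C'" "set C' \<subseteq> A" "z \<in> set C'" "z \<notin> C" for C' z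
      using nb that unfolding bigger_cycle_def by blast
    define W where "W = A - C"
    define w where "w = hd ps"
    have wW: "w \<in> W" "w \<noteq> x" using ps(3) hd_in_set[OF psne] hdps by (auto simp: W_def w_def)
    \<comment> \<open>With an empty gap the detour could be inserted without losing a
      vertex.\<close>
    have G: "G \<noteq> []"
    proof
      assume "G = []"
      then have "is_cycle E (Q @ ps)" using wQ ps dQG C by (intro is_cycle_close) auto
      then show False using nocyc[of "Q @ ps" w] C \<open>G = []\<close> ps CA wW psne by (auto simp: W_def w_def)
    qed
    \<comment> \<open>Such a detour would bypass only a proper part of \<open>G\<close>, against
      minimality.\<close>
    have nodet: "\<not> detour E A C x ps' u (hd Q) \<and> \<not> detour E A C x ps' (last Q) u"
      if uG: "u \<in> set G" for u ps'
    proof -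
      obtain G1 G2 where G12: "G = G1 @ u # G2" using uG by (meson split_list)
      have "\<not> detour E A C x ps' u (hd Q)"
      proof
        assume "detour E A C x ps' u (hd Q)"
        then have "gap E A C x (Q @ G1 @ [u]) G2 ps'"
          using cyc C G12 Q dQG by (auto simp: gap_def)
        from min[OF this] G12 show False by simp
      qed
      moreover have "\<not> detour E A C x ps' (last Q) u"
      proof
        assume "detour E A C x ps' (last Q) u"
        moreover have "is_cycle E ((u # G2 @ Q) @ G1)"
          using is_cycle_rotate[of E "Q @ G1" "u # G2"] cyc G12
            is_cycle_rotate[of E "u # G2 @ Q @ G1" "[]"] by simp
        ultimately have "gap E A C x (u # G2 @ Q) G1 ps'"
          using C G12 Q dQG last_in_set[of Q] by (auto simp: gap_def)
        from min[OF this] G12 show False by simp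
      qed
      ultimately show ?thesis ..
    qed
    have uw: "(u, w) \<notin> E" if "u \<in> set G" for u
      using nodet[OF that, of ps] ps by (auto simp: detour_def w_def)
    have wu: "(w, u) \<notin> E" if "u \<in> set G" for u
      using nodet[OF that, of "[w]"] ps wW by (auto simp: detour_def w_def W_def)
    have wzu: "\<not> ((w, z) \<in> E \<and> (z, u) \<in> E)" if "u \<in> set G" "z \<in> W" for u z
      using nodet[OF that(1), of "[w, z]"] ps wW that irr
      by (auto simp: detour_def w_def W_def is_walk_Cons irrefl_def)
    \<comment> \<open>Either \<open>z # ps\<close> or the part of \<open>ps\<close> from
      \<open>z\<close> on leads from \<open>u\<close> to \<open>hd Q\<close>. The only such list
      that is not a detour is \<open>[x]\<close>, so \<open>x\<close> then ends
      \<open>ps\<close>.\<close>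
    have uzw: "z = x \<and> last ps = x" if "u \<in> set G" "z \<in> W" "(u, z) \<in> E" "(z, w) \<in> E" for u z
    proof (cases "z \<in> set ps")
      case False
      then have "detour E A C x (z # ps) u (hd Q)"
        using that ps psne by (auto simp: detour_def w_def W_def is_walk_Cons)
      with nodet that show ?thesis by blast
    next
      case True
      then obtain p1 p2 where p: "ps = p1 @ z # p2" by (meson split_list)
      have "is_walk E (z # p2)" using ps(1) p is_walk_appendD2 by blast
      then have "z # p2 \<noteq> [x] \<Longrightarrow> detour E A C x (z # p2) u (hd Q)"
        using that ps p by (auto simp: detour_def)
      with nodet[OF that(1)] have "z # p2 = [x]" by blast
      with p show ?thesis by simp
    qed
    \<comment> \<open>The ways to absorb vertices of the gap into \<open>Q\<close> with its ends
      fixed; a longest one admits no further insertion.\<close>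
    define \<Q> where "\<Q> = {Q'. is_walk E Q' \<and> distinct Q' \<and> hd Q' = hd Q \<and> last Q' = last Q \<and>
      set Q \<subseteq> set Q' \<and> set Q' \<subseteq> C}"
    have finC: "finite C" using C by simp
    have "Q \<in> \<Q>" using wQ dQG C by (auto simp: \<Q>_def)
    moreover have "length Q' \<le> card C" if "Q' \<in> \<Q>" for Q'
      using that finC by (auto simp: \<Q>_def distinct_card[symmetric] intro: card_mono)
    ultimately obtain Q' where Q': "Q' \<in> \<Q>" and maxQ: "\<And>R. R \<in> \<Q> \<Longrightarrow> length R \<le> length Q'"
      using ex_has_greatest_nat[of "\<lambda>R. R \<in> \<Q>" Q length "card C + 1"] by (metis less_Suc_eq_le Suc_eq_plus1)
    have q': "is_walk E Q'" "distinct Q'" "hd Q' = hd Q" "last Q' = last Q" "set Q \<subseteq> set Q'" "set Q' \<subseteq> C"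
      using Q' by (auto simp: \<Q>_def)
    have q'ne: "Q' \<noteq> []" using q' is_walk_not_Nil by blast
    define U where "U = C - set Q'"
    have UG: "U \<subseteq> set G" using q' C by (auto simp: U_def)
    have Une: "U \<noteq> {}"
    proof
      assume "U = {}"
      then have "C \<subseteq> set Q'" by (auto simp: U_def)
      moreover have "is_cycle E (Q' @ ps)" using q' ps by (intro is_cycle_close) auto
      ultimately show False using nocyc[of "Q' @ ps" w] q' ps CA wW psne by (auto simp: W_def w_def)
    qed
    \<comment> \<open>Preferring \<open>last G\<close> ensures that \<open>last G\<close> is not
      left over at all when \<epsilon> is 1.\<close>
    define u where "u = (if last G \<in> U then last G else SOME u. u \<in> U)"
    have uU: "u \<in> U" using Une by (auto simp: u_def intro: someI)
    then have uG: "u \<in> set G" and uC: "u \<in> C" using UG C by auto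
    define \<epsilon> where "\<epsilon> = (if x \<in> W \<and> (u, x) \<in> E \<and> (x, w) \<in> E then 1 else (0::nat))"
    have cG: "card (set G) = length G" using dQG by (simp add: distinct_card)
    \<comment> \<open>The extra unit is paid for by \<open>last G\<close>: if it were
      \<open>u\<close>, then \<open>x\<close>, being also \<open>last ps\<close>, could be inserted
      between \<open>last G\<close> and \<open>hd Q\<close>.\<close>
    have key: "card U + \<epsilon> \<le> length G"
    proof (cases "\<epsilon> = 0")
      case True
      then show ?thesis using card_mono[OF _ UG] cG by simp
    next
      case False
      then have ex: "x \<in> W" "(u, x) \<in> E" "(x, w) \<in> E" by (auto simp: \<epsilon>_def split: if_splits)
      have lx: "last ps = x" using uzw[OF uG ex] by simp
      have "last G \<notin> U"
      proof
        assume "last G \<in> U"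
        then have "u = last G" by (simp add: u_def)
        then have "is_cycle E ((Q @ G) @ [x])"
          using cyc ex lx ps G Q C by (intro is_cycle_close) (auto simp: is_cycle_def W_def)
        then show False using nocyc[of "(Q @ G) @ [x]" x] C ex CA by (auto simp: W_def)
      qed
      then have "U \<subseteq> set G - {last G}" using UG by auto
      then have "card U \<le> card (set G - {last G})" by (intro card_mono) auto
      also have "\<dots> = length G - 1" using cG G by simp
      finally show ?thesis using G by (cases G) (auto simp: \<epsilon>_def)
    qed
    have dwC: "deg_into E C w \<le> length Q + 1"
    proof -
      have "deg_into E C w = deg_into E (set Q) w"
        using uw wu C by (intro deg_into_supp) auto
      also have "\<dots> \<le> length Q + 1"
      proof (rule deg_into_no_insert)
        show "w \<notin> set Q" using wW C by (auto simp: W_def)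
        fix P R assume PR: "Q = P @ R" "P \<noteq> []" "R \<noteq> []"
        show "\<not> ((last P, w) \<in> E \<and> (w, hd R) \<in> E)"
        proof
          assume "(last P, w) \<in> E \<and> (w, hd R) \<in> E"
          then have "is_cycle E ((R @ G @ P) @ [w])"
            using is_cycle_rotate[of E P "R @ G"] cyc PR wW C
            by (intro is_cycle_close) (auto simp: is_cycle_def W_def)
          then show False using nocyc[of "(R @ G @ P) @ [w]" w] C wW PR CA by (auto simp: W_def)
        qed
      qed (use dQG Q in auto)
      finally show ?thesis .
    qed
    have duQ: "deg_into E (set Q') u \<le> length Q' + 1"
    proof (rule deg_into_no_insert)
      show "u \<notin> set Q'" using uU by (simp add: U_def)
      fix P R assume PR: "Q' = P @ R" "P \<noteq> []" "R \<noteq> []"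
      show "\<not> ((last P, u) \<in> E \<and> (u, hd R) \<in> E)"
      proof
        assume a: "(last P, u) \<in> E \<and> (u, hd R) \<in> E"
        have "is_walk E (P @ [u] @ R)" using a q'(1) PR by (simp add: is_walk_append is_walk_Cons)
        then have "P @ [u] @ R \<in> \<Q>" using PR q' uU uC by (auto simp: \<Q>_def U_def)
        from maxQ[OF this] PR show False by simp
      qed
    qed (use q' q'ne in auto)
    have duU: "deg_into E U u \<le> 2 * (card U - 1)"
      using uU irr finC by (intro deg_into_le_self) (auto simp: U_def)
    have duC: "deg_into E C u = deg_into E (set Q') u + deg_into E U u"
      unfolding U_def using finC q' by (intro deg_into_split) auto
    have dW: "deg_into E W w + deg_into E W u \<le> 2 * (card W - 1) + \<epsilon>"
      unfolding \<epsilon>_def using fin wW irr uw wu wzu uzw uG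
      by (intro off_cycle_degree_sum) (auto simp: W_def)
    have dA: "deg_into E A v = deg_into E C v + deg_into E W v" for v
      unfolding W_def using fin CA by (intro deg_into_split) auto
    have cU: "card U + length Q' = card C"
      using q' finC card_Diff_subset[of "set Q'" C] card_mono[of C "set Q'"]
      by (simp add: U_def distinct_card)
    have cC: "length Q + length G = card C" using dQG C distinct_card[of "Q @ G"] by simp
    have cA: "card C + card W = card A"
      using fin CA finC card_Diff_subset[of C A] card_mono[of A C] by (simp add: W_def)
    have U1: "1 \<le> card U" using Une finC by (simp add: U_def Suc_le_eq card_gt_0_iff)
    have W1: "1 \<le> card W" using wW fin by (auto simp: W_def Suc_le_eq card_gt_0_iff)
    \<comment> \<open>The bounds add up to \<open>length Q + card C + card U\<close> + \<epsilon> +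
      \<open>2 * card W - 2\<close>, and \<open>key\<close> replaces \<open>card U\<close> +
      \<epsilon> by \<open>length G\<close>.\<close>
    have "deg_into E A w + deg_into E A u \<le> 2 * card A - 2"
      using dA[of w] dA[of u] dwC duQ duU duC dW cU cC cA U1 W1 key by linarith
    moreover have "nonadj E w u" using uw wu uG wW uC by (auto simp: nonadj_def W_def)
    ultimately have "light_pair E A C x" using wW uC by (auto simp: light_pair_def W_def)
    with \<open>\<not> light_pair E A C x\<close> show False ..
  qed
qed

text \<open>Without detours a path from \<open>w\<close> can only return to \<open>C\<close> at
  \<open>c\<close>, so \<open>c\<close> is the only neighbour of \<open>w\<close> on
  \<open>C\<close>. Any other cycle vertex \<open>u\<close> shares almost nothing with
  \<open>w\<close> off the cycle, and \<open>w\<close>, \<open>u\<close> form the light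
  pair.\<close>

lemma no_detour_light_pair:
  assumes fin: "finite A" and irr: "irrefl E" and str: "strong_on E A" and CA: "C \<subseteq> A"
    and c2: "2 \<le> card C" and nodet: "\<And>ps a b. a \<in> C \<Longrightarrow> b \<in> C \<Longrightarrow> a \<noteq> b \<Longrightarrow> \<not> detour E A C x ps a b"
    and cw: "c \<in> C" "w \<in> A - C - {x}" "(c, w) \<in> E"
  shows "light_pair E A C x"
proof -
  define W where "W = A - C"
  have finC: "finite C" using fin CA finite_subset by blast
  have wW: "w \<in> W" "w \<noteq> x" using cw by (auto simp: W_def)
  obtain xs where xs: "is_walk E xs" "distinct xs" "hd xs = w" "last xs = c" "set xs \<subseteq> A"
    using strong_on_path[OF str, of w c] cw CA by blast
  have "\<exists>b\<in>set xs. b \<in> C" using xs cw is_walk_not_Nil last_in_set by metis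
  then obtain ps b zs where sp: "xs = ps @ b # zs" "b \<in> C" "\<forall>p\<in>set ps. p \<notin> C"
    using split_list_first_prop[of xs "\<lambda>b. b \<in> C"] by blast
  have psne: "ps \<noteq> []" using sp xs wW by (auto simp: W_def)
  have ps: "is_walk E ps" "distinct ps" "hd ps = w" "(last ps, b) \<in> E" "set ps \<subseteq> W"
    using xs sp psne by (auto simp: is_walk_append W_def)
  have psx: "ps \<noteq> [x]" using ps wW by auto
  have "detour E A C x ps c b" using ps psx cw by (auto simp: detour_def W_def)
  then have bc: "b = c" using nodet cw sp by blast
  have "C \<noteq> {c}" using c2 by auto
  then obtain u where u: "u \<in> C" "u \<noteq> c" using cw by auto
  have uw: "(v, w) \<notin> E" if "v \<in> C" "v \<noteq> c" for v
  proof
    assume "(v, w) \<in> E"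
    then have "detour E A C x ps v c" using ps psx bc by (auto simp: detour_def W_def)
    then show False using nodet that cw by blast
  qed
  have wu: "(w, v) \<notin> E" if "v \<in> C" "v \<noteq> c" for v
  proof
    assume "(w, v) \<in> E"
    then have "detour E A C x [w] c v" using wW cw by (auto simp: detour_def W_def)
    then show False using nodet that cw by blast
  qed
  have wzu: "\<not> ((w, z) \<in> E \<and> (z, u) \<in> E)" if "z \<in> W" for z
  proof
    assume "(w, z) \<in> E \<and> (z, u) \<in> E"
    then have "detour E A C x [w, z] c u" using wW cw that irr
      by (auto simp: detour_def W_def is_walk_Cons irrefl_def)
    then show False using nodet u cw by blast
  qed
  have uzw: "z = x" if "z \<in> W" "(u, z) \<in> E" "(z, w) \<in> E" for z
  proof (rule ccontr)
    assume zx: "z \<noteq> x"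
    have "\<exists>ps'. detour E A C x ps' u c"
    proof (cases "z \<in> set ps")
      case False
      then have "detour E A C x (z # ps) u c"
        using that ps psne bc zx by (auto simp: detour_def W_def is_walk_Cons)
      then show ?thesis ..
    next
      case True
      then obtain p1 p2 where p: "ps = p1 @ z # p2" by (meson split_list)
      have "is_walk E (z # p2)" using ps(1) p is_walk_appendD2 by blast
      then have "detour E A C x (z # p2) u c"
        using that ps p zx bc by (auto simp: detour_def W_def)
      then show ?thesis ..
    qed
    then show False using nodet u cw by blast
  qed
  define \<epsilon> where "\<epsilon> = (if x \<in> W \<and> (u, x) \<in> E \<and> (x, w) \<in> E then 1 else (0::nat))"
  have dW: "deg_into E W w + deg_into E W u \<le> 2 * (card W - 1) + \<epsilon>"
    unfolding \<epsilon>_def using fin wW irr uw wu wzu uzw u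
    by (intro off_cycle_degree_sum) (auto simp: W_def)
  \<comment> \<open>If \<epsilon> is 1, then \<open>w -> c\<close> is missing, since otherwise
    \<open>[x, w]\<close> would be a detour from \<open>u\<close> to \<open>c\<close>.\<close>
  have dwC: "deg_into E C w + \<epsilon> \<le> 2"
  proof -
    have d: "deg_into E C w = deg_into E {c} w"
      using uw wu cw by (intro deg_into_supp) auto
    show ?thesis
    proof (cases "\<epsilon> = 0")
      case True
      then show ?thesis using d deg_into_le[of "{c}" E w] by simp
    next
      case False
      then have ex: "x \<in> W" "(u, x) \<in> E" "(x, w) \<in> E" by (auto simp: \<epsilon>_def split: if_splits)
      have "(w, c) \<notin> E"
      proof
        assume "(w, c) \<in> E"
        then have "detour E A C x [x, w] u c" using ex wW
          by (auto simp: detour_def W_def is_walk_Cons)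
        then show False using nodet u cw by blast
      qed
      then have "{v \<in> {c}. (w, v) \<in> E} = {}" by auto
      then have "card {v \<in> {c}. (w, v) \<in> E} = 0" by (simp only: card.empty)
      moreover have "card {v \<in> {c}. (v, w) \<in> E} \<le> card {c}" by (intro card_mono) auto
      moreover have "card {c} = 1" by simp
      ultimately have "deg_into E {c} w \<le> 1" unfolding deg_into_def by linarith
      then show ?thesis using d by (simp add: \<epsilon>_def)
    qed
  qed
  have duC: "deg_into E C u \<le> 2 * (card C - 1)"
    using u irr finC by (intro deg_into_le_self) auto
  have dA: "deg_into E A v = deg_into E C v + deg_into E W v" for v
    unfolding W_def using fin CA by (intro deg_into_split) auto
  have cA: "card C + card W = card A"
    using fin CA finC card_Diff_subset[of C A] card_mono[of A C] by (simp add: W_def)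
  have W1: "1 \<le> card W" using wW fin by (auto simp: W_def Suc_le_eq card_gt_0_iff)
  have "deg_into E A w + deg_into E A u \<le> 2 * card A - 2"
    using dA[of w] dA[of u] dwC duC dW cA W1 c2 by linarith
  moreover have "nonadj E w u" using uw[of u] wu[of u] u wW by (auto simp: nonadj_def W_def)
  ultimately show ?thesis using wW u by (auto simp: light_pair_def W_def)
qed

text \<open>A shortest gap is used if there is any. Otherwise no detour exists, and the cases are an
  arc between \<open>C\<close> and a vertex off it other than \<open>x\<close>, or none.\<close>

lemma cycle_extension:
  assumes fin: "finite A" and irr: "irrefl E" and str: "strong_on E A"
    and C: "is_cycle E C" "set C \<subseteq> A" and s: "s \<in> A - set C - {x}"
  shows "bigger_cycle E A (set C) \<or> light_pair E A (set C) x"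
proof (cases "\<exists>Q G ps. gap E A (set C) x Q G ps")
  case True
  then obtain n where "\<exists>Q G ps. gap E A (set C) x Q G ps \<and> length G = n" by blast
  then obtain m where "\<exists>Q G ps. gap E A (set C) x Q G ps \<and> length G = m"
    and minm: "\<And>k. \<exists>Q G ps. gap E A (set C) x Q G ps \<and> length G = k \<Longrightarrow> m \<le> k"
    using exists_least_iff[of "\<lambda>n. \<exists>Q G ps. gap E A (set C) x Q G ps \<and> length G = n"]
    by (metis not_le)
  then obtain Q G ps where g: "gap E A (set C) x Q G ps" "length G = m" by blast
  show ?thesis
  proof (cases "hd ps = x")
    case False
    then show ?thesis using minimal_gap_extends[OF fin irr C(2) g(1)] minm g by blast
  next
    case True
    \<comment> \<open>A detour that starts at \<open>x\<close> does not end there, so reversing all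
      arcs restores the condition on its first vertex.\<close>
    have p: "is_walk E ps" "distinct ps" "ps \<noteq> [x]" using g by (auto simp: gap_def detour_def)
    then have "last ps \<noteq> x" using True is_walk_not_Nil[OF p(1)] by (cases ps) auto
    then have l: "hd (rev ps) \<noteq> x" by (simp add: hd_rev)
    have irr': "irrefl (E\<inverse>)" using irr by (auto simp: irrefl_def)
    have "bigger_cycle (E\<inverse>) A (set C) \<or> light_pair (E\<inverse>) A (set C) x"
    proof (rule minimal_gap_extends[OF fin irr' C(2) gap_converse[OF g(1)] l])
      fix Q' G' ps' assume "gap (E\<inverse>) A (set C) x Q' G' ps'"
      from gap_converse[OF this] have "gap E A (set C) x (rev Q') (rev G') (rev ps')" by simp
      then show "length (rev G) \<le> length G'" using minm[of "length G'"] g(2) by (metis length_rev)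
    qed
    then show ?thesis by (simp add: bigger_cycle_converse light_pair_converse)
  qed
next
  case False
  have nodet: "\<not> detour E A (set C) x ps a b" if ab: "a \<in> set C" "b \<in> set C" "a \<noteq> b" for ps a b
  proof
    assume d: "detour E A (set C) x ps a b"
    obtain C1 C2 where C12: "C = C1 @ b # C2" using ab by (meson split_list)
    have r: "is_cycle E (b # C2 @ C1)" using is_cycle_rotate[of E C1 "b # C2"] C C12 by simp
    have "a \<in> set (C2 @ C1)" using ab C12 by auto
    then obtain D1 D2 where D: "C2 @ C1 = D1 @ a # D2" by (meson split_list)
    have "set C = insert b (set (C2 @ C1))" using C12 by auto
    then have "set ((b # D1 @ [a]) @ D2) = set C" using D by auto
    moreover have "is_cycle E ((b # D1 @ [a]) @ D2)" using r D by simp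
    ultimately have "gap E A (set C) x (b # D1 @ [a]) D2 ps" using d ab by (auto simp: gap_def)
    with False show False by blast
  qed
  have c2: "2 \<le> card (set C)" using C by (auto simp: is_cycle_def distinct_card)
  show ?thesis
  proof (cases "\<exists>c\<in>set C. \<exists>w\<in>A - set C - {x}. (c, w) \<in> E \<or> (w, c) \<in> E")
    case True
    then obtain c w where cw: "c \<in> set C" "w \<in> A - set C - {x}" "(c, w) \<in> E \<or> (w, c) \<in> E" by blast
    from cw(3) show ?thesis
    proof
      assume "(c, w) \<in> E"
      then show ?thesis
        using no_detour_light_pair[OF fin irr str C(2) c2 _ cw(1,2)] nodet by blast
    next
      assume "(w, c) \<in> E"
      moreover have "\<not> detour (E\<inverse>) A (set C) x ps a b"
        if "a \<in> set C" "b \<in> set C" "a \<noteq> b" for ps a b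
        using nodet[of b a "rev ps"] detour_converse[of E A "set C" x "rev ps" a b] that by auto
      moreover have "irrefl (E\<inverse>)" using irr by (auto simp: irrefl_def)
      ultimately have "light_pair (E\<inverse>) A (set C) x"
        using no_detour_light_pair[of A "E\<inverse>" "set C" x c w] fin str C(2) c2 cw
        by (simp add: strong_on_converse)
      then show ?thesis by (simp add: light_pair_converse)
    qed
  next
    case False
    \<comment> \<open>Here \<open>s\<close> has no neighbour on \<open>C\<close>, and a cycle vertex
      has at most \<open>x\<close> as a neighbour off \<open>C\<close>.\<close>
    have sC: "s \<in> A" "s \<notin> set C" "s \<noteq> x" using s by auto
    obtain u where u: "u \<in> set C" using C by (cases C) (auto simp: is_cycle_def)
    define W where "W = A - set C"
    have "deg_into E (set C) s = 0" using False sC by (intro deg_into_eq_0) auto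
    moreover have "deg_into E W s \<le> 2 * (card W - 1)"
      using sC irr fin by (intro deg_into_le_self) (auto simp: W_def)
    moreover have "deg_into E (set C) u \<le> 2 * (card (set C) - 1)"
      using u irr by (intro deg_into_le_self) auto
    moreover have "deg_into E W u \<le> 2"
    proof -
      have "deg_into E W u = deg_into E (W \<inter> {x}) u"
        using False u by (intro deg_into_supp) (auto simp: W_def)
      also have "\<dots> \<le> deg_into E {x} u" by (intro deg_into_mono) auto
      also have "\<dots> \<le> 2" using deg_into_le[of "{x}" E u] by simp
      finally show ?thesis .
    qed
    moreover have "deg_into E A v = deg_into E (set C) v + deg_into E W v" for v
      unfolding W_def using fin C by (intro deg_into_split) auto
    moreover have "card (set C) + card W = card A"
      using fin C card_Diff_subset[of "set C" A] card_mono[of A "set C"] by (simp add: W_def)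
    moreover have "1 \<le> card W" using sC fin by (auto simp: W_def Suc_le_eq card_gt_0_iff)
    ultimately have "deg_into E A s + deg_into E A u \<le> 2 * card A - 2" using c2 by simp
    moreover have "nonadj E s u" using False sC u by (auto simp: nonadj_def)
    ultimately show ?thesis using sC u by (auto simp: light_pair_def)
  qed
qed

text \<open>Taking the vertex \<open>x\<close> or \<open>y\<close> that a longest cycle misses as the exceptional vertex
  of the extension lemma, the light pair it produces is never \<open>{x, y}\<close>.\<close>
lemma near_hamiltonian_cycle:
  assumes fin: "finite A" and irr: "irrefl E" and str: "strong_on E A"
    and C0: "is_cycle E C0" "set C0 \<subseteq> A"
    and deg: "\<And>u v. u \<in> A \<Longrightarrow> v \<in> A \<Longrightarrow> nonadj E u v \<Longrightarrow> {u, v} \<noteq> {x, y} \<Longrightarrow>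
      2 * card A \<le> deg_into E A u + deg_into E A v + 1"
  obtains C where "is_cycle E C" "set C0 \<subseteq> set C" "set C \<subseteq> A" "A - set C \<subseteq> {x} \<or> A - set C \<subseteq> {y}"
proof -
  define P where "P C \<longleftrightarrow> is_cycle E C \<and> set C0 \<subseteq> set C \<and> set C \<subseteq> A" for C
  have "P C0" using C0 by (simp add: P_def)
  moreover have "card (set C) < card A + 1" if "P C" for C
    using that fin card_mono[of A "set C"] by (auto simp: P_def)
  ultimately obtain C where C: "P C" and max: "\<And>C'. P C' \<Longrightarrow> card (set C') \<le> card (set C)"
    using ex_has_greatest_nat[of P C0 "\<lambda>C. card (set C)" "card A + 1"] by blast
  have nbig: "\<not> bigger_cycle E A (set C)"
  proof
    assume "bigger_cycle E A (set C)"
    then obtain C' where C': "is_cycle E C'" "set C \<subset> set C'" "set C' \<subseteq> A"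
      by (auto simp: bigger_cycle_def)
    then have "P C'" using C by (auto simp: P_def)
    moreover have "card (set C) < card (set C')" using C' by (intro psubset_card_mono) auto
    ultimately show False using max by fastforce
  qed
  define t where "t = (if x \<in> set C then y else x)"
  have A1: "1 \<le> card A" if "z \<in> A" for z using that fin by (auto simp: Suc_le_eq card_gt_0_iff)
  have "A - set C \<subseteq> {t}"
  proof (rule ccontr)
    assume "\<not> A - set C \<subseteq> {t}"
    then obtain s where "s \<in> A - set C - {t}" by auto
    then have "light_pair E A (set C) t"
      using cycle_extension[OF fin irr str, of C s t] C nbig by (auto simp: P_def)
    then obtain w u where wu: "w \<in> A - set C - {t}" "u \<in> set C" "nonadj E w u"
      "deg_into E A w + deg_into E A u \<le> 2 * card A - 2" by (auto simp: light_pair_def)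
    \<comment> \<open>If \<open>x\<close> is on \<open>C\<close>, then \<open>w\<close> is off
      \<open>C\<close> and differs from \<open>t = y\<close>. If not, then \<open>u\<close> is not
      \<open>x\<close>, and \<open>w\<close> differs from \<open>t = x\<close>.\<close>
    have "{w, u} \<noteq> {x, y}" using wu(1,2) by (auto simp: t_def doubleton_eq_iff split: if_splits)
    then show False using deg[of w u] wu C A1[of w] by (auto simp: P_def)
  qed
  then show thesis using that[of C] C by (auto simp: P_def t_def split: if_splits)
qed

subsection \<open>Two disjoint paths, and strong semicomplete digraphs\<close>

text \<open>Walks suffice, as only vertex sets matter for disjointness; \<open>connects_trim\<close>
  later makes them paths. A single vertex of \<open>A\<close> and \<open>B\<close> counts.\<close>

definition connects :: "('a \<times> 'a) set \<Rightarrow> 'a set \<Rightarrow> 'a set \<Rightarrow> 'a list \<Rightarrow> bool" where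
  "connects E A B xs \<longleftrightarrow> is_walk E xs \<and> hd xs \<in> A \<and> last xs \<in> B"

lemma is_walk_mono: "is_walk F xs \<Longrightarrow> F \<subseteq> E \<Longrightarrow> is_walk E xs"
  unfolding is_walk_def by (auto intro: successively_mono)

text \<open>The walk is cut before its first use of the new arc.\<close>

lemma is_walk_insert_prefix:
  assumes "is_walk (insert (u, v) F) xs"
  shows "is_walk F xs \<or> (\<exists>P R. xs = P @ R \<and> is_walk F P \<and> last P = u)"
  using assms
proof (induction xs)
  case (Cons x xs)
  show ?case
  proof (cases "xs = []")
    case False
    then have w: "(x, hd xs) \<in> insert (u, v) F" "is_walk (insert (u, v) F) xs"
      using Cons.prems by (auto simp: is_walk_Cons)
    show ?thesis
    proof (cases "(x, hd xs) \<in> F")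
      case True
      from Cons.IH[OF w(2)] show ?thesis
      proof
        assume "is_walk F xs"
        with True show ?thesis by (simp add: is_walk_Cons)
      next
        assume "\<exists>P R. xs = P @ R \<and> is_walk F P \<and> last P = u"
        then obtain P R where "xs = P @ R" "is_walk F P" "last P = u" by blast
        moreover then have "P \<noteq> []" using is_walk_not_Nil by blast
        ultimately have "x # xs = (x # P) @ R \<and> is_walk F (x # P) \<and> last (x # P) = u"
          using True by (simp add: is_walk_Cons)
        then show ?thesis by blast
      qed
    next
      case False
      then have "x # xs = [x] @ xs \<and> is_walk F [x] \<and> last [x] = u" using w by simp
      then show ?thesis by blast
    qed
  qed simp
qed (simp add: is_walk_def)

text \<open>The walk is cut after its last use of the new arc.\<close>

lemma is_walk_insert_suffix:
  assumes "is_walk (insert (u, v) F) xs"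
  shows "is_walk F xs \<or> (\<exists>P R. xs = P @ R \<and> is_walk F R \<and> hd R = v)"
  using assms
proof (induction xs)
  case (Cons x xs)
  show ?case
  proof (cases "xs = []")
    case False
    then have w: "(x, hd xs) \<in> insert (u, v) F" "is_walk (insert (u, v) F) xs"
      using Cons.prems by (auto simp: is_walk_Cons)
    from Cons.IH[OF w(2)] show ?thesis
    proof
      assume a: "is_walk F xs"
      show ?thesis
      proof (cases "(x, hd xs) \<in> F")
        case True
        with a show ?thesis by (simp add: is_walk_Cons)
      next
        case False
        then have "x # xs = [x] @ xs \<and> is_walk F xs \<and> hd xs = v" using w a by simp
        then show ?thesis by blast
      qed
    next
      assume "\<exists>P R. xs = P @ R \<and> is_walk F R \<and> hd R = v"
      then show ?thesis by (metis append_Cons)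
    qed
  qed simp
qed (simp add: is_walk_def)

lemma connects_prefix:
  assumes "connects E A B xs" "s \<in> set xs"
  obtains P R where "xs = P @ s # R" "connects E A {s} (P @ [s])" "s \<notin> set P"
proof -
  obtain P R where P: "xs = P @ s # R" "s \<notin> set P" using split_list_first[OF assms(2)] by blast
  then have e: "xs = (P @ [s]) @ R" by simp
  then have "is_walk E (P @ [s])" using assms(1) is_walk_appendD1[of E "P @ [s]" R]
    by (simp add: connects_def)
  moreover have "hd (P @ [s]) \<in> A" using assms(1) P by (cases P) (auto simp: connects_def)
  ultimately show thesis using that[of P R] P by (simp add: connects_def)
qed

lemma connects_suffix:
  assumes "connects E A B xs" "s \<in> set xs"
  obtains P R where "xs = P @ s # R" "connects E {s} B (s # R)" "s \<notin> set R"
proof -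
  obtain P R where P: "xs = P @ s # R" "s \<notin> set R" using split_list_last[OF assms(2)] by blast
  then have "is_walk E (s # R)" using assms(1) is_walk_appendD2[of E P "s # R"]
    by (simp add: connects_def)
  then show thesis using that[of P R] P assms(1) by (simp add: connects_def)
qed

text \<open>Menger's theorem for two walks, following Goering: if deleting the arc \<open>(u, v)\<close> creates a
  separating vertex \<open>s\<close>, the walks are glued at \<open>s\<close> and along \<open>(u, v)\<close>.\<close>
lemma two_disjoint_walks:
  assumes "finite E" "\<And>s. \<exists>xs. connects E A B xs \<and> s \<notin> set xs"
  shows "\<exists>xs ys. connects E A B xs \<and> connects E A B ys \<and> set xs \<inter> set ys = {}"
  using assms
proof (induction E arbitrary: A B rule: finite_induct)
  case empty
  have single: "\<exists>a. xs = [a] \<and> a \<in> A \<and> a \<in> B" if "connects {} A B xs" for xs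
    using that by (cases xs; cases "tl xs") (auto simp: connects_def is_walk_def)
  obtain xs where xs: "connects {} A B xs" using empty by blast
  then obtain a where a: "xs = [a]" using single by blast
  obtain ys where ys: "connects {} A B ys" "a \<notin> set ys" using empty by blast
  show ?case using a xs ys by (intro exI[of _ xs] exI[of _ ys]) auto
next
  case (insert e F)
  obtain u v where e: "e = (u, v)" by (cases e)
  show ?case
  proof (cases "\<forall>s. \<exists>xs. connects F A B xs \<and> s \<notin> set xs")
    case True
    then obtain xs ys where "connects F A B xs" "connects F A B ys" "set xs \<inter> set ys = {}"
      using insert.IH[of A B] by blast
    then show ?thesis unfolding connects_def using is_walk_mono[of F _ "insert e F"] by blast
  next
    case False
    then obtain s where s: "\<And>xs. connects F A B xs \<Longrightarrow> s \<in> set xs" by blast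
    \<comment> \<open>A walk from \<open>A\<close> to \<open>B\<close> either stays in
      \<open>F\<close> and then meets \<open>s\<close>, or starts with an \<open>F\<close>-walk to
      \<open>u\<close>. Hence no single vertex separates \<open>A\<close> from \<open>{s, u}\<close>
      in \<open>F\<close>, nor, dually, \<open>{s, v}\<close> from \<open>B\<close>.\<close>
    have "\<exists>xs. connects F A {s, u} xs \<and> t \<notin> set xs" for t
    proof -
      obtain xs where xs: "connects (insert e F) A B xs" "t \<notin> set xs" using insert.prems by blast
      then have "is_walk (insert (u, v) F) xs" by (simp add: connects_def e)
      from is_walk_insert_prefix[OF this] show ?thesis
      proof
        assume "is_walk F xs"
        then have c: "connects F A B xs" using xs by (simp add: connects_def)
        obtain P R where "xs = P @ s # R" "connects F A {s} (P @ [s])"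
          using connects_prefix[OF c s[OF c]] by blast
        then show ?thesis using xs by (intro exI[of _ "P @ [s]"]) (auto simp: connects_def)
      next
        assume "\<exists>P R. xs = P @ R \<and> is_walk F P \<and> last P = u"
        then obtain P R where "xs = P @ R" "is_walk F P" "last P = u" by blast
        moreover then have "P \<noteq> []" using is_walk_not_Nil by blast
        ultimately show ?thesis using xs by (intro exI[of _ P]) (auto simp: connects_def)
      qed
    qed
    then obtain X1 X2 where X: "connects F A {s, u} X1" "connects F A {s, u} X2" "set X1 \<inter> set X2 = {}"
      using insert.IH[of A "{s, u}"] by blast
    have "\<exists>xs. connects F {s, v} B xs \<and> t \<notin> set xs" for t
    proof -
      obtain xs where xs: "connects (insert e F) A B xs" "t \<notin> set xs" using insert.prems by blast
      then have "is_walk (insert (u, v) F) xs" by (simp add: connects_def e)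
      from is_walk_insert_suffix[OF this] show ?thesis
      proof
        assume "is_walk F xs"
        then have c: "connects F A B xs" using xs by (simp add: connects_def)
        obtain P R where "xs = P @ s # R" "connects F {s} B (s # R)"
          using connects_suffix[OF c s[OF c]] by blast
        then show ?thesis using xs by (intro exI[of _ "s # R"]) (auto simp: connects_def)
      next
        assume "\<exists>P R. xs = P @ R \<and> is_walk F R \<and> hd R = v"
        then obtain P R where "xs = P @ R" "is_walk F R" "hd R = v" by blast
        moreover then have "R \<noteq> []" using is_walk_not_Nil by blast
        ultimately show ?thesis using xs by (intro exI[of _ R]) (auto simp: connects_def)
      qed
    qed
    then obtain Y1 Y2 where Y: "connects F {s, v} B Y1" "connects F {s, v} B Y2" "set Y1 \<inter> set Y2 = {}"
      using insert.IH[of "{s, v}" B] by blast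
    \<comment> \<open>Disjoint walks end in different vertices of \<open>{s, u}\<close>, hence one
      in each.\<close>
    have "\<exists>X1 X2. connects F A {s} X1 \<and> connects F A {u} X2 \<and> set X1 \<inter> set X2 = {}"
    proof -
      have "last X1 \<in> set X1" "last X2 \<in> set X2"
        using X is_walk_not_Nil by (auto simp: connects_def intro!: last_in_set)
      then have "last X1 \<noteq> last X2" using X(3) by auto
      then have "last X1 = s \<and> last X2 = u \<or> last X2 = s \<and> last X1 = u"
        using X by (auto simp: connects_def)
      then show ?thesis using X by (auto simp: connects_def Int_commute)
    qed
    then obtain X1 X2 where X: "connects F A {s} X1" "connects F A {u} X2" "set X1 \<inter> set X2 = {}" by blast
    have "\<exists>Y1 Y2. connects F {s} B Y1 \<and> connects F {v} B Y2 \<and> set Y1 \<inter> set Y2 = {}"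
    proof -
      have "hd Y1 \<in> set Y1" "hd Y2 \<in> set Y2"
        using Y is_walk_not_Nil by (auto simp: connects_def intro!: hd_in_set)
      then have "hd Y1 \<noteq> hd Y2" using Y(3) by auto
      then have "hd Y1 = s \<and> hd Y2 = v \<or> hd Y2 = s \<and> hd Y1 = v"
        using Y by (auto simp: connects_def)
      then show ?thesis using Y by (auto simp: connects_def Int_commute)
    qed
    then obtain Y1 Y2 where Y: "connects F {s} B Y1" "connects F {v} B Y2" "set Y1 \<inter> set Y2 = {}" by blast
    have "X1 \<noteq> []" "last X1 = s" using X(1) is_walk_not_Nil by (auto simp: connects_def)
    then have "s \<in> set X1" using last_in_set by metis
    then obtain P R' where P: "X1 = P @ s # R'" "connects F A {s} (P @ [s])" "s \<notin> set P"
      using connects_prefix[OF X(1)] by blast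
    have "Y1 \<noteq> []" "hd Y1 = s" using Y(1) is_walk_not_Nil by (auto simp: connects_def)
    then have "s \<in> set Y1" using hd_in_set by metis
    then obtain P' R where R: "Y1 = P' @ s # R" "connects F {s} B (s # R)" "s \<notin> set R"
      using connects_suffix[OF Y(1)] by blast
    have sX2: "s \<notin> set X2" using X(3) \<open>s \<in> set X1\<close> by auto
    have sY2: "s \<notin> set Y2" using Y(3) \<open>s \<in> set Y1\<close> by auto
    \<comment> \<open>Joined at \<open>t\<close>, the two walks form an \<open>F\<close>-walk from
      \<open>A\<close> to \<open>B\<close>. It must contain \<open>s\<close>, which the hypotheses
      allow only at \<open>t\<close>.\<close>
    have cross: "t = s" if t: "connects F A S1 X" "connects F S2 B Y" "t \<in> set X" "t \<in> set Y"
      "s \<notin> set (butlast X)" "s \<notin> set (tl Y)" for S1 S2 X Y t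
    proof -
      obtain p r where p: "X = p @ t # r" "connects F A {t} (p @ [t])"
        using connects_prefix[OF t(1,3)] by blast
      obtain p' r' where r: "Y = p' @ t # r'" "connects F {t} B (t # r')"
        using connects_suffix[OF t(2,4)] by blast
      have "is_walk F (p @ t # r')"
        using p(2) r(2) by (cases "p = []") (auto simp: connects_def is_walk_append)
      moreover have "hd (p @ t # r') \<in> A" using p(2) by (cases p) (auto simp: connects_def)
      ultimately have "connects F A B (p @ t # r')" using r(2) by (auto simp: connects_def)
      then have "s \<in> set (p @ t # r')" by (rule s)
      moreover have "s \<notin> set p" using t(5) p(1) by (auto simp: butlast_append split: if_splits)
      moreover have "s \<notin> set r'" using t(6) r(1) by (cases p') auto
      ultimately show ?thesis by simp
    qed
    have bX2: "s \<notin> set (butlast X2)" using sX2 in_set_butlastD by metis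
    have tY2: "s \<notin> set (tl Y2)" using sY2 by (cases Y2) auto
    have c12: "set (P @ [s]) \<inter> set Y2 = {}"
      using cross[OF P(2) Y(2) _ _ _ tY2] P(3) sY2 by (metis butlast_snoc disjoint_iff)
    have c21: "set X2 \<inter> set (s # R) = {}"
      using cross[OF X(2) R(2) _ _ bX2] R(3) sX2 by (metis list.sel(3) disjoint_iff)
    have XYsub: "set P \<subseteq> set X1" "set R \<subseteq> set Y1" using P R by auto
    have wP: "is_walk F (P @ s # R)"
      using P(2) R(2) by (cases "P = []") (auto simp: connects_def is_walk_append)
    have "hd (P @ s # R) \<in> A" using P(2) by (cases P) (auto simp: connects_def)
    then have c1: "connects (insert e F) A B (P @ s # R)"
      using wP R(2) is_walk_mono[OF wP, of "insert e F"] by (auto simp: connects_def)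
    have ne: "X2 \<noteq> []" "Y2 \<noteq> []" using X Y is_walk_not_Nil by (auto simp: connects_def)
    have "is_walk (insert e F) (X2 @ Y2)"
      using X(2) Y(2) ne is_walk_mono[of F _ "insert e F"] e
      by (auto simp: connects_def is_walk_append)
    then have c2: "connects (insert e F) A B (X2 @ Y2)"
      using X(2) Y(2) ne by (auto simp: connects_def)
    have "set (P @ s # R) \<inter> set (X2 @ Y2) = {}"
      using c12 c21 X(3) Y(3) XYsub by auto
    with c1 c2 show ?thesis by blast
  qed
qed

text \<open>A shortest walk from \<open>L\<close> to \<open>R\<close> within \<open>set xs\<close>
  works: any further vertex of \<open>L\<close> or \<open>R\<close>, or any repetition, would
  shorten it.\<close>

lemma connects_trim:
  assumes "connects E L R xs" "L \<inter> R = {}"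
  obtains ys where "connects E L R ys" "distinct ys" "set ys \<subseteq> set xs"
    "set (tl ys) \<inter> L = {}" "set (butlast ys) \<inter> R = {}"
proof -
  define S where "S ys \<longleftrightarrow> connects E L R ys \<and> set ys \<subseteq> set xs" for ys
  have "S xs" using assms by (simp add: S_def)
  then obtain ys where ys: "S ys" and min: "\<And>zs. S zs \<Longrightarrow> length ys \<le> length zs"
    using ex_has_least_nat[of S xs length] by blast
  have c: "connects E L R ys" "set ys \<subseteq> set xs" using ys by (auto simp: S_def)
  have suf: "r = ys" if "ys = p @ r" "r \<noteq> []" "hd r \<in> L" for p r
  proof -
    have "is_walk E r" using c(1) that is_walk_appendD2[of E p r] by (simp add: connects_def)
    then have "S r" using c that by (auto simp: S_def connects_def)
    from min[OF this] that show ?thesis by simp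
  qed
  have pre: "p = ys" if "ys = p @ r" "p \<noteq> []" "last p \<in> R" for p r
  proof -
    have "is_walk E p" using c(1) that is_walk_appendD1[of E p r] by (simp add: connects_def)
    then have "S p" using c that by (auto simp: S_def connects_def)
    from min[OF this] that show ?thesis by simp
  qed
  have "set (tl ys) \<inter> L = {}"
  proof (rule ccontr)
    assume "set (tl ys) \<inter> L \<noteq> {}"
    then obtain t where t: "t \<in> set (tl ys)" "t \<in> L" by auto
    then obtain p r where p: "tl ys = p @ t # r" by (meson split_list)
    have "ys \<noteq> []" using t by auto
    then have "ys = (hd ys # p) @ t # r" using p by (cases ys) auto
    then have "t # r = ys" using suf[of "hd ys # p" "t # r"] t by simp
    with \<open>ys = (hd ys # p) @ t # r\<close> show False by (metis append_self_conv2 list.distinct(1))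
  qed
  moreover have "set (butlast ys) \<inter> R = {}"
  proof (rule ccontr)
    assume "set (butlast ys) \<inter> R \<noteq> {}"
    then obtain t where t: "t \<in> set (butlast ys)" "t \<in> R" by auto
    then obtain p r where p: "butlast ys = p @ t # r" by (meson split_list)
    have "ys \<noteq> []" using t by auto
    then have y: "ys = (p @ [t]) @ r @ [last ys]" using p append_butlast_last_id[of ys] by simp
    then have "p @ [t] = ys" using pre[of "p @ [t]" "r @ [last ys]"] t by simp
    then have "length (p @ [t]) = length ys" by simp
    moreover have "length ys = length (p @ [t]) + length r + 1" using arg_cong[OF y, of length] by simp
    ultimately show False by simp
  qed
  moreover have "distinct ys"
  proof (rule ccontr)
    assume "\<not> distinct ys"
    then obtain p q r t where d: "ys = p @ [t] @ q @ [t] @ r" using not_distinct_decomp by blast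
    have w: "is_walk E (p @ t # r)"
    proof -
      have "is_walk E ((p @ [t]) @ q @ [t] @ r)" using c(1) d by (simp add: connects_def)
      then have "is_walk E (p @ [t])" by (rule is_walk_appendD1) simp
      moreover have "is_walk E ((p @ [t] @ q) @ [t] @ r)" using c(1) d by (simp add: connects_def)
      then have "is_walk E ([t] @ r)" by (rule is_walk_appendD2) simp
      ultimately show ?thesis by (cases "p = []") (auto simp: is_walk_append)
    qed
    have "hd (p @ t # r) = hd ys" "last (p @ t # r) = last ys" using d by (cases p; auto)+
    then have "S (p @ t # r)" using w c d by (auto simp: S_def connects_def)
    from min[OF this] d show False by simp
  qed
  ultimately show thesis using that c by blast
qed

section \<open>Cycles in strong semicomplete digraphs\<close>

lemma strong_on_cut:
  assumes "strong_on E A" "S \<subseteq> A" "a \<in> S" "b \<in> A - S"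
  obtains u v where "u \<in> S" "v \<in> A - S" "(u, v) \<in> E"
proof -
  have "(a, b) \<in> (Restr E A)\<^sup>*" using assms by (auto simp: strong_on_def)
  then have "b \<in> S \<or> (\<exists>u\<in>S. \<exists>v\<in>A - S. (u, v) \<in> E)"
    by (induction rule: rtrancl_induct) (use assms in auto)
  then show thesis using assms that by blast
qed

text \<open>Moon's argument: a vertex joined in both directions to the cycle can be inserted; otherwise
  some arc leads from a vertex dominated by the cycle to one dominating it, and that arc replaces
  a vertex of the cycle.\<close>
lemma semicomplete_cycle_step:
  assumes fin: "finite A" and str: "strong_on E A"
    and semi: "\<And>u v. u \<in> A \<Longrightarrow> v \<in> A \<Longrightarrow> u \<noteq> v \<Longrightarrow> (u, v) \<in> E \<or> (v, u) \<in> E"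
    and C: "is_cycle E C" "set C \<subseteq> A" "length C < card A"
  shows "\<exists>C'. is_cycle E C' \<and> set C' \<subseteq> A \<and> length C' = Suc (length C)"
proof (cases "\<exists>w\<in>A - set C. (\<exists>c\<in>set C. (c, w) \<in> E) \<and> (\<exists>c\<in>set C. (w, c) \<in> E)")
  case True
  then obtain w a b where w: "w \<in> A" "w \<notin> set C" "a \<in> set C" "(a, w) \<in> E" "b \<in> set C" "(w, b) \<in> E"
    by blast
  obtain C1 C2 where C12: "C = C1 @ a # C2" using w by (meson split_list)
  define D where "D = a # C2 @ C1"
  have D: "is_cycle E D" "set D = set C" "length D = length C" "hd D = a"
    using is_cycle_rotate[of E C1 "a # C2"] C C12 by (auto simp: D_def)
  \<comment> \<open>An empty \<open>R\<close> stands for the place between the last and the first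
    vertex of \<open>D\<close>.\<close>
  have "\<exists>P R. D = P @ R \<and> P \<noteq> [] \<and> (last P, w) \<in> E \<and> (w, if R = [] then hd D else hd R) \<in> E"
  proof (rule ccontr)
    assume neg: "\<not> ?thesis"
    \<comment> \<open>Beginning with \<open>a -> w\<close>, a failed insertion forces the next
      vertex to dominate \<open>w\<close>. This spreads over the whole cycle, and
      \<open>w -> b\<close> then allows an insertion.\<close>
    have "\<forall>p\<in>set P. (p, w) \<in> E" if "D = P @ R" for P R
      using that
    proof (induction P arbitrary: R rule: rev_induct)
      case (snoc p P)
      show ?case
      proof (cases "P = []")
        case True
        then show ?thesis using snoc.prems D w by auto
      next
        case False
        then have IH: "\<forall>q\<in>set P. (q, w) \<in> E" using snoc by auto
        then have "(last P, w) \<in> E" using False by simp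
        moreover have "D = P @ (p # R)" using snoc.prems by simp
        ultimately have "(w, p) \<notin> E" using neg False by fastforce
        moreover have "p \<in> A" "p \<noteq> w" using snoc.prems D C w by auto
        ultimately have "(p, w) \<in> E" using semi[of p w] w by blast
        with IH show ?thesis by simp
      qed
    qed simp
    then have all: "\<forall>p\<in>set D. (p, w) \<in> E" by (metis append_Nil2)
    obtain p r where pr: "D = p @ b # r" using w D by (metis split_list)
    show False
    proof (cases "p = []")
      case True
      then have "hd D = b" using pr by simp
      moreover have "D \<noteq> []" using pr by simp
      ultimately show False using neg all w by (metis append_Nil2 last_in_set)
    next
      case False
      then have "(last p, w) \<in> E" using all pr by simp
      then show False using neg pr False w by fastforce
    qed
  qed
  then obtain P R where PR: "D = P @ R" "P \<noteq> []" "(last P, w) \<in> E" "(w, if R = [] then hd D else hd R) \<in> E"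
    by blast
  have "is_cycle E (R @ P)" using D PR is_cycle_rotate[of E P R] by simp
  moreover have "hd (R @ P) = (if R = [] then hd D else hd R)" using PR by auto
  ultimately have "is_cycle E ((R @ P) @ [w])"
    using PR D w by (intro is_cycle_close) (auto simp: is_cycle_def)
  moreover have "length ((R @ P) @ [w]) = Suc (length C)" using PR D by simp
  moreover have "set ((R @ P) @ [w]) \<subseteq> A" using PR D C w by auto
  ultimately show ?thesis by blast
next
  case False
  define X where "X = {w \<in> A - set C. \<forall>c\<in>set C. (c, w) \<in> E \<and> (w, c) \<notin> E}"
  define Y where "Y = {w \<in> A - set C. \<forall>c\<in>set C. (w, c) \<in> E \<and> (c, w) \<notin> E}"
  have XY: "w \<in> X \<or> w \<in> Y" if "w \<in> A - set C" for w
    using False semi that C(2) unfolding X_def Y_def by blast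
  have dC: "distinct C" "2 \<le> length C" "card (set C) = length C" using C by (auto simp: is_cycle_def distinct_card)
  have "set C \<noteq> A" using C dC by auto
  then obtain s where s: "s \<in> A - set C" using C by auto
  obtain c where c: "c \<in> set C" using dC by (cases C) auto
  obtain u v where uv: "u \<in> set C" "v \<in> A - set C" "(u, v) \<in> E"
    using strong_on_cut[OF str C(2) c s] by blast
  then have vX: "v \<in> X" using XY[of v] by (auto simp: Y_def)
  have "c \<in> A - X" "X \<subseteq> A" using c C by (auto simp: X_def)
  \<comment> \<open>The arc leaves \<open>X\<close>, and its head is not on \<open>C\<close> because
    vertices of \<open>X\<close> send no arc to \<open>C\<close>.\<close>
  then obtain p q where pq: "p \<in> X" "q \<in> A - X" "(p, q) \<in> E"
    using strong_on_cut[OF str _ vX] by blast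
  have "q \<notin> set C" using pq by (auto simp: X_def)
  then have qY: "q \<in> Y" using XY pq by blast
  \<comment> \<open>The vertex \<open>b\<close> is given up and \<open>p\<close>, \<open>q\<close>
    are placed after \<open>a\<close>, a net gain of one.\<close>
  obtain a b zs where zs: "C = a # b # zs" using dC by (cases C; cases "tl C") auto
  have "a \<in> set C" using zs by simp
  have pqd: "p \<noteq> q" "p \<in> A" "q \<in> A" "p \<notin> set C" "q \<notin> set C" using pq qY by (auto simp: X_def Y_def)
  have wz: "is_walk E (zs @ [a])"
  proof -
    have "is_cycle E (zs @ [a, b])" using is_cycle_rotate[of E "[a, b]" zs] C zs by simp
    then have "is_walk E ((zs @ [a]) @ [b])" by (simp add: is_cycle_def)
    then show ?thesis by (rule is_walk_appendD1) simp
  qed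
  have "hd (zs @ [a]) \<in> set C" using zs by (cases zs) auto
  then have "is_cycle E ((zs @ [a]) @ [p, q])"
    using wz zs dC pqd pq qY by (intro is_cycle_close) (auto simp: is_walk_Cons X_def Y_def)
  moreover have "length ((zs @ [a]) @ [p, q]) = Suc (length C)" using zs by simp
  moreover have "set ((zs @ [a]) @ [p, q]) \<subseteq> A" using zs C pqd by auto
  ultimately show ?thesis by blast
qed

text \<open>A shortest cycle has at most three vertices, and from there every length is reached one
  by one.\<close>

lemma semicomplete_pancyclic:
  assumes fin: "finite A" and str: "strong_on E A" and irr: "irrefl E"
    and semi: "\<And>u v. u \<in> A \<Longrightarrow> v \<in> A \<Longrightarrow> u \<noteq> v \<Longrightarrow> (u, v) \<in> E \<or> (v, u) \<in> E"
    and m: "3 \<le> m" "m \<le> card A"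
  shows "\<exists>C. is_cycle E C \<and> length C = m"
proof -
  obtain T where "T \<subseteq> A" "card T = 2" using m obtain_subset_with_card_n[of 2 A] by auto
  then obtain a b where ab: "a \<in> A" "b \<in> A" "a \<noteq> b" by (auto simp: card_2_iff)
  define P where "P C \<longleftrightarrow> is_cycle E C \<and> set C \<subseteq> A" for C
  obtain C0 where "P C0" using strong_on_ex_cycle[OF str ab] by (auto simp: P_def)
  then obtain C where C: "P C" and min: "\<And>D. P D \<Longrightarrow> length C \<le> length D"
    using ex_has_least_nat[of P C0 length] by blast
  have l3: "length C \<le> 3"
  proof (rule ccontr)
    assume "\<not> length C \<le> 3"
    then have "4 \<le> length C" by simp
    then obtain c1 c2 c3 c4 zs where zs: "C = c1 # c2 # c3 # c4 # zs" by (rule length_ge_4)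
    have cy: "is_cycle E C" "set C \<subseteq> A" using C by (auto simp: P_def)
    have "c1 \<in> A" "c3 \<in> A" "c1 \<noteq> c3" using cy zs by (auto simp: is_cycle_def)
    \<comment> \<open>One direction of this chord skips \<open>c2\<close>, the other closes a
      triangle; both give a shorter cycle.\<close>
    then have "(c1, c3) \<in> E \<or> (c3, c1) \<in> E" using semi by blast
    then show False
    proof
      assume "(c1, c3) \<in> E"
      then have "P (c1 # c3 # c4 # zs)" using cy zs by (auto simp: P_def is_cycle_def is_walk_Cons)
      from min[OF this] zs show False by simp
    next
      assume "(c3, c1) \<in> E"
      then have "P [c1, c2, c3]" using cy zs by (auto simp: P_def is_cycle_def is_walk_Cons)
      from min[OF this] zs show False by simp
    qed
  qed
  have "length C + k \<le> card A \<Longrightarrow> \<exists>D. is_cycle E D \<and> set D \<subseteq> A \<and> length D = length C + k" for k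
  proof (induction k)
    case 0
    then show ?case using C by (auto simp: P_def)
  next
    case (Suc k)
    then obtain D where "is_cycle E D" "set D \<subseteq> A" "length D = length C + k" by auto
    then show ?case using semicomplete_cycle_step[OF fin str semi, of D] Suc.prems by auto
  qed
  from this[of "m - length C"] m l3 show ?thesis by auto
qed

subsection \<open>A cycle through both vertices\<close>

lemma card_ge_avoid:
  assumes "finite F" "card F < card S"
  obtains s where "s \<in> S" "s \<notin> F"
proof -
  have "\<not> S \<subseteq> F" using assms card_mono[of F S] by auto
  then show thesis using that by blast
qed

lemma is_walk_Restr_subset:
  assumes "is_walk (Restr E B) p" "hd p \<in> B"
  shows "set p \<subseteq> B \<and> is_walk E p"
  using assms
proof (induction p)
  case (Cons a p)
  then show ?case by (cases "p = []") (auto simp: is_walk_Cons)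
qed (simp add: is_walk_def)

text \<open>The situation to be refuted. It is invariant under exchanging \<open>x\<close> and
  \<open>y\<close> and under reversing all arcs, so each result inside is available in these
  variants through \<open>swap\<close> and \<open>reverse\<close>.\<close>

locale no_common_cycle =
  fixes V :: "'a set" and E :: "('a \<times> 'a) set" and x y :: 'a
  assumes fin: "finite V" and EV: "E \<subseteq> V \<times> V" and irr: "irrefl E"
    and xV: "x \<in> V" and yV: "y \<in> V" and xy: "nonadj E x y"
    and strong: "strong_on E V" and two_strong: "\<And>v. v \<in> V \<Longrightarrow> strong_on E (V - {v})"
    and deg: "\<And>u v. u \<in> V \<Longrightarrow> v \<in> V \<Longrightarrow> nonadj E u v \<Longrightarrow> {u, v} \<noteq> {x, y} \<Longrightarrow>
      2 * card V + 1 \<le> deg_into E V u + deg_into E V v"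
    and no_cycle: "\<And>C. is_cycle E C \<Longrightarrow> x \<in> set C \<Longrightarrow> y \<in> set C \<Longrightarrow> False"
begin

lemma swap: "no_common_cycle V E y x"
proof
  fix u v assume "u \<in> V" "v \<in> V" "nonadj E u v" "{u, v} \<noteq> {y, x}"
  then show "2 * card V + 1 \<le> deg_into E V u + deg_into E V v" using deg[of u v] by blast
qed (use fin EV irr xV yV nonadj_sym[OF xy] strong two_strong no_cycle in blast)+

lemma reverse: "no_common_cycle V (E\<inverse>) x y"
proof
  fix C assume "is_cycle (E\<inverse>) C" "x \<in> set C" "y \<in> set C"
  then show False using no_cycle[of "rev C"] is_cycle_rev[of "E\<inverse>" C] by simp
next
  fix u v assume "u \<in> V" "v \<in> V" "nonadj (E\<inverse>) u v" "{u, v} \<noteq> {x, y}"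
  then show "2 * card V + 1 \<le> deg_into (E\<inverse>) V u + deg_into (E\<inverse>) V v"
    using deg[of u v] by (simp add: nonadj_converse deg_into_converse)
next
  show "irrefl (E\<inverse>)" using irr by (auto simp: irrefl_def)
next
  show "E\<inverse> \<subseteq> V \<times> V" using EV by auto
qed (simp_all add: fin xV yV xy strong two_strong nonadj_converse strong_on_converse)

text \<open>Reachability avoiding \<open>F\<close>; the start vertex itself is not required to lie outside \<open>F\<close>.\<close>
definition rch :: "'a set \<Rightarrow> 'a \<Rightarrow> 'a \<Rightarrow> bool" where
  "rch F a b \<longleftrightarrow> (a, b) \<in> (Restr E (V - F))\<^sup>*"

lemma rch_walk: "is_walk E xs \<Longrightarrow> set xs \<subseteq> V - F \<Longrightarrow> hd xs = a \<Longrightarrow> last xs = b \<Longrightarrow> rch F a b"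
  using walk_imp_rtrancl[of E xs "V - F"] unfolding rch_def by simp

lemma rch_trans: "rch F a b \<Longrightarrow> rch F b c \<Longrightarrow> rch F a c"
  by (simp add: rch_def)

lemma rch_arc: "(a, b) \<in> E \<Longrightarrow> a \<notin> F \<Longrightarrow> b \<notin> F \<Longrightarrow> rch F a b"
  using EV unfolding rch_def by blast

lemma rch_target: "rch F a b \<Longrightarrow> b = a \<or> b \<in> V - F"
  unfolding rch_def by (induction rule: rtrancl_induct) auto

text \<open>All vertices on the walk are themselves reachable avoiding \<open>F\<close>, so none of
  them lies in \<open>F'\<close>.\<close>

lemma rch_change:
  assumes "rch F a b" "\<And>t. t \<in> F' \<Longrightarrow> \<not> rch F a t"
  shows "rch F' a b"
  using assms(1) unfolding rch_def
proof (induction rule: rtrancl_induct)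
  case (step b c)
  have "rch F a b" "rch F a c" using step by (auto simp: rch_def intro: rtrancl_into_rtrancl)
  then have "b \<notin> F'" "c \<notin> F'" using assms(2) by blast+
  then have "(b, c) \<in> Restr E (V - F')" using step by auto
  then show ?case using step by (simp add: rtrancl_into_rtrancl)
qed simp

lemma arcD: "(a, b) \<in> E \<Longrightarrow> a \<in> V \<and> b \<in> V \<and> a \<noteq> b"
  using EV irr by (auto simp: irrefl_def)

lemma xy_arc: "(x, y) \<notin> E" "(y, x) \<notin> E" "x \<noteq> y"
  using xy by (auto simp: nonadj_def)

section \<open>Separation of \<open>x\<close> from \<open>y\<close> by arcs\<close>

lemma path_avoiding:
  assumes "v \<in> V" "v \<noteq> x" "v \<noteq> y"
  obtains S where "is_walk E S" "distinct S" "hd S = x" "last S = y" "set S \<subseteq> V - {v}"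
proof -
  have "x \<in> V - {v}" "y \<in> V - {v}" using assms xV yV by auto
  from strong_on_path[OF two_strong[OF assms(1)] this] show thesis using that by blast
qed

text \<open>A path from \<open>x\<close> to \<open>y\<close> that avoids \<open>v\<close> would be
  closed to a cycle by \<open>y -> v -> x\<close>.\<close>

lemma no_common_neighbour:
  assumes "(y, v) \<in> E" "(v, x) \<in> E" shows False
proof -
  have v: "v \<in> V" "v \<noteq> x" "v \<noteq> y" using assms arcD by blast+
  obtain S where S: "is_walk E S" "distinct S" "hd S = x" "last S = y" "set S \<subseteq> V - {v}"
    using path_avoiding[OF v] by blast
  have "is_cycle E (S @ [v])" using S assms by (intro is_cycle_close) auto
  moreover have "x \<in> set (S @ [v])" "y \<in> set (S @ [v])"
    using S is_walk_not_Nil[OF S(1)] hd_in_set[of S] last_in_set[of S] by auto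
  ultimately show False by (rule no_cycle)
qed

text \<open>A path from \<open>x\<close> to \<open>y\<close> that avoids \<open>z\<close> and
  \<open>v\<close> would be closed to a cycle by \<open>y -> z -> v -> x\<close>.\<close>

lemma separates:
  assumes "(y, z) \<in> E" "(z, v) \<in> E" "(v, x) \<in> E" shows "\<not> rch {z, v} x y"
proof
  assume r: "rch {z, v} x y"
  have zv: "z \<noteq> v" "x \<noteq> z" "x \<noteq> v" "y \<noteq> z" "y \<noteq> v"
    using assms arcD xy_arc by blast+
  obtain S where S: "is_walk E S" "distinct S" "hd S = x" "last S = y" "set S \<subseteq> V - {z, v}"
    using rtrancl_imp_path[of x y E "V - {z, v}"] r zv xV unfolding rch_def by blast
  have "is_cycle E (S @ [z, v])" using S assms zv by (intro is_cycle_close) (auto simp: is_walk_Cons)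
  moreover have "x \<in> set (S @ [z, v])" "y \<in> set (S @ [z, v])"
    using S is_walk_not_Nil[OF S(1)] hd_in_set[of S] last_in_set[of S] by auto
  ultimately show False by (rule no_cycle)
qed

text \<open>The four neighbourhoods have total size at least \<open>2 * card V + 1\<close> but lie
  in \<open>V - {u, v}\<close>, so counting them in two pairs leaves an excess of 5. Vertices
  \<open>w\<close> with \<open>v -> w -> u\<close> that lie outside the second pair's union reduce
  the room for that union, so they need not be counted.\<close>

lemma two_step_count:
  assumes "u \<in> V" "v \<in> V" "nonadj E u v" "{u, v} \<noteq> {x, y}"
  shows "5 \<le> card {w. (v, w) \<in> E \<and> (w, u) \<in> E \<and> ((w, v) \<in> E \<or> (u, w) \<in> E)}
    + card {w. (u, w) \<in> E \<and> (w, v) \<in> E}"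
proof -
  define Ou where "Ou = {w \<in> V. (u, w) \<in> E}"
  define Iu where "Iu = {w \<in> V. (w, u) \<in> E}"
  define Ov where "Ov = {w \<in> V. (v, w) \<in> E}"
  define Iv where "Iv = {w \<in> V. (w, v) \<in> E}"
  define U where "U = V - {u, v}"
  have sub: "Ou \<subseteq> U" "Iu \<subseteq> U" "Ov \<subseteq> U" "Iv \<subseteq> U"
    using assms(3) arcD by (auto simp: Ou_def Iu_def Ov_def Iv_def U_def nonadj_def)
  have finU: "finite U" using fin by (simp add: U_def)
  then have fs: "finite Ou" "finite Iu" "finite Ov" "finite Iv" using sub finite_subset by blast+
  define W where "W = Ov \<inter> Iu"
  have 1: "card Ov + card Iu \<le> card U + card W"
    unfolding W_def using finU sub by (intro card_add_le)
  have 2: "card Iv + card Ou = card (Iv \<union> Ou) + card (Iv \<inter> Ou)"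
    using fs by (intro card_Un_Int) auto
  have "card (Iv \<union> Ou) + card (W - (Iv \<union> Ou)) = card ((Iv \<union> Ou) \<union> (W - (Iv \<union> Ou)))"
    using fs by (intro card_Un_disjoint[symmetric]) (auto simp: W_def)
  also have "\<dots> \<le> card U" using finU sub by (intro card_mono) (auto simp: W_def)
  finally have 3: "card (Iv \<union> Ou) + card (W - (Iv \<union> Ou)) \<le> card U" .
  have 4: "card W = card (W \<inter> (Iv \<union> Ou)) + card (W - (Iv \<union> Ou))"
    using fs by (intro card_Int_Diff) (auto simp: W_def)
  have 5: "card U + 2 = card V"
  proof -
    have "card V = card U + card {u, v}"
      using card_Diff_subset[of "{u, v}" V] card_mono[OF fin, of "{u, v}"] assms by (simp add: U_def)
    then show ?thesis using assms(3) by (auto simp: nonadj_def)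
  qed
  have 6: "2 * card V + 1 \<le> card Ou + card Iu + (card Ov + card Iv)"
    using deg[OF assms] by (simp add: deg_into_def Ou_def Iu_def Ov_def Iv_def)
  have "{w. (v, w) \<in> E \<and> (w, u) \<in> E \<and> ((w, v) \<in> E \<or> (u, w) \<in> E)} = W \<inter> (Iv \<union> Ou)"
    using EV by (auto simp: W_def Ou_def Iu_def Ov_def Iv_def)
  moreover have "{w. (u, w) \<in> E \<and> (w, v) \<in> E} = Iv \<inter> Ou"
    using EV by (auto simp: Ou_def Iv_def)
  ultimately show ?thesis using 1 2 3 4 5 6 by simp
qed

lemma finite_succ: "finite {u. (a, u) \<in> E \<and> P u}" "finite {u. (u, a) \<in> E \<and> P u}"
  using finite_subset[OF _ fin, of "{u. (a, u) \<in> E \<and> P u}"]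
    finite_subset[OF _ fin, of "{u. (u, a) \<in> E \<and> P u}"] EV by auto

text \<open>If \<open>w\<close> preceded \<open>v\<close>, then \<open>z1\<close> would lie before \<open>w\<close> on the walk and the arc \<open>z1 \<rightarrow> v\<close>
  would bypass \<open>w\<close>, contradicting that \<open>z \<rightarrow> w\<close> separates \<open>x\<close> from \<open>y\<close>.\<close>
lemma no_double_before:
  assumes z: "(y, z) \<in> E" and z1: "(y, z1) \<in> E" "(z1, v) \<in> E" "z1 \<noteq> z" "rch {z1, v} z y"
    and v: "(v, x) \<in> E" and w: "(z, w) \<in> E" "(w, x) \<in> E" "(w, z) \<in> E"
    and S: "is_walk E (A @ w # B @ v # D)" "distinct (A @ w # B @ v # D)"
      "hd (A @ w # B @ v # D) = x" "last (A @ w # B @ v # D) = y" "set (A @ w # B @ v # D) \<subseteq> V - {z}"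
  shows False
proof -
  have z1w: "z1 \<noteq> w" using z1 w no_common_neighbour by blast
  have hdA: "hd (A @ [w]) = x" using S(3) by (cases A) auto
  have "is_walk E ((A @ [w]) @ B @ v # D)" using S(1) by simp
  then have wA: "is_walk E (A @ [w])" by (rule is_walk_appendD1) simp
  \<comment> \<open>Otherwise the walk along \<open>A\<close> to \<open>w\<close>, the arc
    \<open>w -> z\<close> and the connection from \<open>z\<close> to \<open>y\<close> avoid
    \<open>z1\<close> and \<open>v\<close>.\<close>
  have "z1 \<in> set A"
  proof (rule ccontr)
    assume "z1 \<notin> set A"
    then have "rch {z1, v} x w" using wA hdA S z1w by (intro rch_walk[of "A @ [w]"]) auto
    moreover have "rch {z1, v} w z" using w z1 z1w S by (intro rch_arc) auto
    ultimately have "rch {z1, v} x y" using z1(4) rch_trans by blast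
    then show False using separates z1 v by blast
  qed
  then obtain A1 A2 where A: "A = A1 @ z1 # A2" by (meson split_list)
  have "is_walk E ((A1 @ [z1]) @ A2 @ [w])" using wA A by simp
  then have "is_walk E (A1 @ [z1])" by (rule is_walk_appendD1) simp
  moreover have "hd (A1 @ [z1]) = x" using hdA A by (cases A1) auto
  ultimately have 1: "rch {z, w} x z1" using S A by (intro rch_walk[of "A1 @ [z1]"]) auto
  have 2: "rch {z, w} z1 v" using z1 z1w S by (intro rch_arc) auto
  have "is_walk E ((A @ w # B) @ v # D)" using S(1) by simp
  then have "is_walk E (v # D)" by (rule is_walk_appendD2) simp
  then have "rch {z, w} v y" using S by (intro rch_walk[of "v # D"]) auto
  with 1 2 have "rch {z, w} x y" using rch_trans by blast
  then show False using separates z w by blast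
qed

text \<open>By \<open>separates\<close>, a path from \<open>x\<close> to \<open>y\<close> avoiding
  \<open>v\<close> contains every \<open>u\<close> with \<open>y -> u -> v\<close>. Let
  \<open>z\<close> be the last one on it: the part after \<open>z\<close> avoids the others, and the
  part up to another one avoids \<open>z\<close>.\<close>

lemma ex_last_cut:
  assumes v: "(v, x) \<in> E" and ne: "\<exists>u. (y, u) \<in> E \<and> (u, v) \<in> E"
  obtains z where "(y, z) \<in> E" "(z, v) \<in> E"
    "\<And>u. (y, u) \<in> E \<Longrightarrow> (u, v) \<in> E \<Longrightarrow> u \<noteq> z \<Longrightarrow> rch {u, v} z y \<and> rch {z, v} x u"
proof -
  have vV: "v \<in> V" "v \<noteq> x" "v \<noteq> y" using v arcD xy_arc by blast+
  obtain R where R: "is_walk E R" "distinct R" "hd R = x" "last R = y" "set R \<subseteq> V - {v}"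
    using path_avoiding[OF vV] by blast
  have inR: "u \<in> set R" if "(y, u) \<in> E" "(u, v) \<in> E" for u
  proof (rule ccontr)
    assume "u \<notin> set R"
    then have "rch {u, v} x y" using R by (intro rch_walk[of R]) auto
    then show False using separates that v by blast
  qed
  then have "\<exists>u\<in>set R. (y, u) \<in> E \<and> (u, v) \<in> E" using ne by blast
  then obtain Ra z Rb where z: "R = Ra @ z # Rb" "(y, z) \<in> E \<and> (z, v) \<in> E"
    "\<forall>u\<in>set Rb. \<not> ((y, u) \<in> E \<and> (u, v) \<in> E)"
    using split_list_last_prop[of R "\<lambda>u. (y, u) \<in> E \<and> (u, v) \<in> E"] by blast
  have "rch {u, v} z y \<and> rch {z, v} x u" if u: "(y, u) \<in> E" "(u, v) \<in> E" "u \<noteq> z" for u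
  proof
    have uRa: "u \<in> set Ra" "u \<notin> set Rb" using inR[OF u(1,2)] z u by auto
    have "is_walk E (z # Rb)" using R(1) z is_walk_appendD2 by blast
    then show "rch {u, v} z y" using R z uRa u(3) by (intro rch_walk[of "z # Rb"]) auto
    obtain p q where p: "Ra = p @ u # q" using uRa by (meson split_list)
    have "is_walk E ((p @ [u]) @ q @ z # Rb)" using R(1) z p by simp
    then have "is_walk E (p @ [u])" by (rule is_walk_appendD1) simp
    moreover have "hd (p @ [u]) = x" using R(3) z p by (cases p) auto
    ultimately show "rch {z, v} x u" using R z p by (intro rch_walk[of "p @ [u]"]) auto
  qed
  then show thesis using that z by blast
qed

text \<open>The last condition says that \<open>z\<close> is the last of the out-neighbours \<open>u\<close> of \<open>y\<close> with \<open>u \<rightarrow> v\<close>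
  on any path from \<open>x\<close> to \<open>y\<close> avoiding \<open>v\<close>.\<close>
definition good :: "'a \<Rightarrow> 'a \<Rightarrow> bool" where
  "good z v \<longleftrightarrow> (y, z) \<in> E \<and> (z, v) \<in> E \<and> (v, x) \<in> E \<and> 3 \<le> card {u. (y, u) \<in> E \<and> (u, v) \<in> E} \<and>
     (\<forall>u. (y, u) \<in> E \<longrightarrow> (u, v) \<in> E \<longrightarrow> u \<noteq> z \<longrightarrow> rch {u, v} z y)"

text \<open>A path from \<open>x\<close> to \<open>y\<close> avoiding \<open>z\<close> contains all \<open>w\<close> with \<open>z \<rightarrow> w \<rightarrow> x\<close>, and by the degree
  condition at least four of these also satisfy \<open>w \<rightarrow> z\<close>. The second of them, \<open>w2\<close>, takes the role
  of \<open>v\<close>.\<close>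
lemma good_ascent:
  assumes "good z v"
  obtains z' v' where "good z' v'" "{u. rch {z, v} x u} \<subset> {u. rch {z', v'} x u}"
proof -
  have zv: "(y, z) \<in> E" "(z, v) \<in> E" "(v, x) \<in> E" and Z3: "3 \<le> card {u. (y, u) \<in> E \<and> (u, v) \<in> E}"
    and last: "\<And>u. (y, u) \<in> E \<Longrightarrow> (u, v) \<in> E \<Longrightarrow> u \<noteq> z \<Longrightarrow> rch {u, v} z y"
    using assms by (auto simp: good_def)
  have zV: "z \<in> V" "z \<noteq> x" "z \<noteq> y" and vV: "v \<in> V" "v \<noteq> x" "v \<noteq> y" and "z \<noteq> v"
    using zv arcD xy_arc by blast+
  obtain z1 where z1: "(y, z1) \<in> E" "(z1, v) \<in> E" "z1 \<noteq> z"
    using card_ge_avoid[of "{z}" "{u. (y, u) \<in> E \<and> (u, v) \<in> E}"] Z3 by auto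
  have xz: "(x, z) \<notin> E"
  proof
    assume "(x, z) \<in> E"
    moreover have "x \<noteq> z1" using z1 xy_arc by blast
    ultimately have "rch {z1, v} x z" using z1 vV \<open>z \<noteq> v\<close> by (intro rch_arc) auto
    then have "rch {z1, v} x y" using last[OF z1] rch_trans by blast
    then show False using separates z1 zv by blast
  qed
  have zx: "(z, x) \<notin> E" using no_common_neighbour zv by blast
  \<comment> \<open>A third out-neighbour \<open>z2\<close> of \<open>y\<close> with
    \<open>z2 -> v\<close> is chosen off \<open>x -> u -> z\<close>, so that this route followed by
    the connection from \<open>z\<close> to \<open>y\<close> bypasses \<open>z2\<close> and
    \<open>v\<close>.\<close>
  have Ax: "u = v" if u: "(x, u) \<in> E" "(u, z) \<in> E" for u
  proof (rule ccontr)
    assume uv: "u \<noteq> v"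
    have "card {z, u} < card {u. (y, u) \<in> E \<and> (u, v) \<in> E}"
      using Z3 card_insert_le_m1[of 2 "{u}" z] by simp
    then obtain z2 where z2: "(y, z2) \<in> E" "(z2, v) \<in> E" "z2 \<noteq> z" "z2 \<noteq> u"
      using card_ge_avoid[of "{z, u}" "{u. (y, u) \<in> E \<and> (u, v) \<in> E}"] by auto
    have "x \<noteq> z2" using z2 xy_arc by blast
    then have "rch {z2, v} x u" using u uv z2 vV by (intro rch_arc) auto
    moreover have "rch {z2, v} u z" using u uv z2 \<open>z \<noteq> v\<close> by (intro rch_arc) auto
    ultimately have "rch {z2, v} x y" using last[OF z2(1,2,3)] rch_trans by blast
    then show False using separates z2 zv by blast
  qed
  obtain S where S: "is_walk E S" "distinct S" "hd S = x" "last S = y" "set S \<subseteq> V - {z}"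
    using path_avoiding[OF zV] by blast
  define W where "W = {w. (z, w) \<in> E \<and> (w, x) \<in> E}"
  define Dbl where "Dbl = {w \<in> W. (w, z) \<in> E}"
  have WS: "w \<in> set S" if "w \<in> W" for w
  proof (rule ccontr)
    assume "w \<notin> set S"
    then have "rch {z, w} x y" using S by (intro rch_walk[of S]) auto
    then show False using separates that zv by (auto simp: W_def)
  qed
  \<comment> \<open>The arc \<open>x -> w\<close> would bypass \<open>w'\<close>, although
    \<open>z\<close> and \<open>w'\<close> separate \<open>x\<close> from \<open>y\<close>.\<close>
  have before: "False" if "w \<in> W" "w' \<in> W" "(x, w) \<in> E" "S = A @ w' # B @ w # D" for w w' A B D
  proof -
    have "is_walk E ((A @ w' # B) @ w # D)" using S that by simp
    then have "is_walk E (w # D)" by (rule is_walk_appendD2) simp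
    then have "rch {z, w'} w y" using S that by (intro rch_walk[of "w # D"]) auto
    moreover have "x \<noteq> w'" "w \<noteq> w'" "w \<noteq> z"
      using that(1,2,4) S(2) arcD[of w' x] arcD[of z w] by (auto simp: W_def)
    then have "rch {z, w'} x w" using that zV by (intro rch_arc) auto
    ultimately have "rch {z, w'} x y" using rch_trans by blast
    then show False using separates zv that by (auto simp: W_def)
  qed
  have one: "w = w'" if ww: "w \<in> W" "w' \<in> W" "(x, w) \<in> E" "(x, w') \<in> E" for w w'
  proof (rule ccontr)
    assume ne: "w \<noteq> w'"
    obtain p q where p: "S = p @ w # q" using WS ww by (meson split_list)
    have "w' \<in> set p \<or> w' \<in> set q" using WS[OF ww(2)] p ne by auto
    then show False
    proof
      assume "w' \<in> set p"
      then obtain a b where "p = a @ w' # b" by (meson split_list)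
      then show False using before[OF ww(1,2,3), of a b q] p by simp
    next
      assume "w' \<in> set q"
      then obtain a b where "q = a @ w' # b" by (meson split_list)
      then show False using before[OF ww(2,1,4), of p a b] p by simp
    qed
  qed
  have finW: "finite W" "finite Dbl" using finite_succ(1)[of z] by (auto simp: W_def Dbl_def)
  \<comment> \<open>Of the five from \<open>two_step_count\<close>, one is lost: either
    \<open>v\<close> as the only \<open>w\<close> with \<open>x -> w -> z\<close>, or the single
    \<open>w\<close> in \<open>W\<close> with \<open>x -> w\<close>. If \<open>x -> v -> z\<close>,
    these coincide and \<open>v\<close> still lies in \<open>Dbl\<close>.\<close>
  have d4: "4 \<le> card Dbl"
  proof -
    define T where "T = {w \<in> W. (w, z) \<in> E \<or> (x, w) \<in> E}"
    have "nonadj E x z" using xz zx zV by (auto simp: nonadj_def)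
    moreover have "{x, z} \<noteq> {x, y}" using zV by (auto simp: doubleton_eq_iff)
    moreover have "{w. (z, w) \<in> E \<and> (w, x) \<in> E \<and> ((w, z) \<in> E \<or> (x, w) \<in> E)} = T"
      by (auto simp: T_def W_def)
    ultimately have 5: "5 \<le> card T + card {w. (x, w) \<in> E \<and> (w, z) \<in> E}"
      using two_step_count[OF xV zV(1)] by simp
    show ?thesis
    proof (cases "(x, v) \<in> E \<and> (v, z) \<in> E")
      case True
      have "v \<in> W" using zv by (simp add: W_def)
      then have "T \<subseteq> Dbl" using one True by (auto simp: T_def Dbl_def)
      then have "card T \<le> card Dbl" using finW by (intro card_mono)
      moreover have "{w. (x, w) \<in> E \<and> (w, z) \<in> E} \<subseteq> {v}" using Ax by auto
      then have "card {w. (x, w) \<in> E \<and> (w, z) \<in> E} \<le> card {v}" by (intro card_mono) auto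
      ultimately show ?thesis using 5 by simp
    next
      case False
      then have "{w. (x, w) \<in> E \<and> (w, z) \<in> E} = {}" using Ax by auto
      then have c0: "card {w. (x, w) \<in> E \<and> (w, z) \<in> E} = 0" by (simp only: card.empty)
      have "T \<subseteq> Dbl \<union> {w \<in> W. (x, w) \<in> E}" by (auto simp: T_def Dbl_def)
      then have "card T \<le> card (Dbl \<union> {w \<in> W. (x, w) \<in> E})" using finW by (intro card_mono) auto
      also have "\<dots> \<le> card Dbl + card {w \<in> W. (x, w) \<in> E}" by (rule card_Un_le)
      also have "card {w \<in> W. (x, w) \<in> E} \<le> 1"
        using one finW card_le_Suc0_iff_eq[of "{w \<in> W. (x, w) \<in> E}"] by auto
      finally show ?thesis using 5 c0 by simp
    qed
  qed
  \<comment> \<open>The filter lists \<open>Dbl\<close> in the order in which \<open>S\<close>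
    visits it.\<close>
  have "set (filter (\<lambda>w. w \<in> Dbl) S) = Dbl" using WS by (auto simp: Dbl_def)
  then have "length (filter (\<lambda>w. w \<in> Dbl) S) = card Dbl"
    using S(2) distinct_card[of "filter (\<lambda>w. w \<in> Dbl) S"] by simp
  then have "4 \<le> length (filter (\<lambda>w. w \<in> Dbl) S)" using d4 by simp
  then obtain w1 w2 w3 w4 rest where "filter (\<lambda>w. w \<in> Dbl) S = w1 # w2 # w3 # w4 # rest"
    by (rule length_ge_4)
  then obtain U0 S1 where S1: "S = U0 @ w1 # S1" "w1 \<in> Dbl"
    "filter (\<lambda>w. w \<in> Dbl) S1 = w2 # w3 # w4 # rest" by (auto dest: filter_eq_ConsD)
  from S1(3) obtain U1 S2 where S2: "S1 = U1 @ w2 # S2" "w2 \<in> Dbl"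
    "filter (\<lambda>w. w \<in> Dbl) S2 = w3 # w4 # rest" by (auto dest: filter_eq_ConsD)
  from S2(3) obtain U2 S3 where S3: "S2 = U2 @ w3 # S3" "w3 \<in> Dbl"
    "filter (\<lambda>w. w \<in> Dbl) S3 = w4 # rest" by (auto dest: filter_eq_ConsD)
  from S3(3) obtain U3 U4 where S4: "S3 = U3 @ w4 # U4" "w4 \<in> Dbl" by (auto dest: filter_eq_ConsD)
  have Sd: "S = U0 @ w1 # U1 @ w2 # U2 @ w3 # U3 @ w4 # U4" using S1 S2 S3 S4 by simp
  have D: "w1 \<in> Dbl" "w2 \<in> Dbl" "w3 \<in> Dbl" "w4 \<in> Dbl" using S1 S2 S3 S4 by auto
  have vW: "v \<in> W" using zv by (simp add: W_def)
  \<comment> \<open>Since \<open>w1\<close> is joined to \<open>z\<close> in both directions, it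
    cannot precede \<open>v\<close>.\<close>
  have vpos: "v \<in> set U0 \<or> v = w1"
  proof (rule ccontr)
    assume "\<not> ?thesis"
    then have "v \<in> set (U1 @ w2 # U2 @ w3 # U3 @ w4 # U4)" using WS[OF vW] Sd by auto
    then obtain B Dd where BD: "U1 @ w2 # U2 @ w3 # U3 @ w4 # U4 = B @ v # Dd" by (meson split_list)
    then have "S = U0 @ w1 # B @ v # Dd" using Sd by simp
    then show False
      using no_double_before[OF zv(1) z1 last[OF z1] zv(3), of w1 U0 B Dd] S D(1)
      by (simp add: Dbl_def W_def)
  qed
  have w2: "(z, w2) \<in> E" "(w2, x) \<in> E" "(w2, z) \<in> E" using D by (auto simp: Dbl_def W_def)
  have w2V: "w2 \<in> V" "w2 \<noteq> x" "w2 \<noteq> y" "w2 \<noteq> z" using w2 arcD xy_arc by blast+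
  have wpre: "is_walk E (U0 @ w1 # U1 @ [w2])"
  proof -
    have "is_walk E ((U0 @ w1 # U1 @ [w2]) @ (U2 @ w3 # U3 @ w4 # U4))" using S Sd by simp
    then show ?thesis by (rule is_walk_appendD1) simp
  qed
  have hdpre: "hd (U0 @ w1 # U1 @ [w2]) = x" using S Sd by (cases U0) auto
  have pre: "rch {z, w} x w2" if "w \<notin> set (U0 @ w1 # U1 @ [w2])" for w
    using wpre hdpre S Sd that by (intro rch_walk[of "U0 @ w1 # U1 @ [w2]"]) auto
  have w34: "w3 \<notin> set (U0 @ w1 # U1 @ [w2])" "w4 \<notin> set (U0 @ w1 # U1 @ [w2])" "w3 \<noteq> w4"
    using S(2) Sd by auto
  have sep: "\<not> rch {z, w3} x y" "\<not> rch {z, w4} x y"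
    using separates[OF zv(1)] D by (auto simp: Dbl_def W_def)
  have w34y: "w3 \<noteq> y" "w4 \<noteq> y" using D xy_arc by (auto simp: Dbl_def W_def)
  have "(w2, y) \<notin> E"
  proof
    assume "(w2, y) \<in> E"
    then have "rch {z, w3} w2 y" using w2V w34 w34y zV by (intro rch_arc) auto
    then show False using pre[OF w34(1)] rch_trans sep by blast
  qed
  moreover have "(y, w2) \<notin> E" using no_common_neighbour w2 by blast
  ultimately have na: "nonadj E w2 y" using w2V by (auto simp: nonadj_def)
  \<comment> \<open>At least one of \<open>w3\<close>, \<open>w4\<close> differs from
    \<open>u\<close>; \<open>S\<close> up to \<open>w2\<close> followed by
    \<open>w2 -> u -> y\<close> would bypass it.\<close>
  have only_z: "u = z" if u: "(w2, u) \<in> E" "(u, y) \<in> E" for u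
  proof (rule ccontr)
    assume "u \<noteq> z"
    have "rch {z, w} x y" if "w \<notin> set (U0 @ w1 # U1 @ [w2])" "u \<noteq> w" "w \<noteq> y" for w
    proof -
      have "rch {z, w} w2 u" using u w2V that \<open>u \<noteq> z\<close> by (intro rch_arc) auto
      moreover have "rch {z, w} u y" using u that \<open>u \<noteq> z\<close> zV by (intro rch_arc) auto
      ultimately show ?thesis using pre[OF that(1)] rch_trans by blast
    qed
    then show False using w34 w34y sep by metis
  qed
  have Z4: "4 \<le> card {u. (y, u) \<in> E \<and> (u, w2) \<in> E}"
  proof -
    have "{w2, y} \<noteq> {x, y}" using w2V by (auto simp: doubleton_eq_iff)
    then have "5 \<le> card {w. (y, w) \<in> E \<and> (w, w2) \<in> E \<and> ((w, y) \<in> E \<or> (w2, w) \<in> E)}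
        + card {w. (w2, w) \<in> E \<and> (w, y) \<in> E}"
      using two_step_count[OF w2V(1) yV na] by simp
    moreover have "card {w. (y, w) \<in> E \<and> (w, w2) \<in> E \<and> ((w, y) \<in> E \<or> (w2, w) \<in> E)}
        \<le> card {u. (y, u) \<in> E \<and> (u, w2) \<in> E}"
      using finite_succ(1)[of y] by (intro card_mono) auto
    moreover have "card {w. (w2, w) \<in> E \<and> (w, y) \<in> E} \<le> card {z}"
      using only_z by (intro card_mono) auto
    ultimately show ?thesis by simp
  qed
  have zw2: "(y, z) \<in> E \<and> (z, w2) \<in> E" using zv w2 by simp
  obtain z' where z': "(y, z') \<in> E" "(z', w2) \<in> E"
    and lz: "\<And>u. (y, u) \<in> E \<Longrightarrow> (u, w2) \<in> E \<Longrightarrow> u \<noteq> z' \<Longrightarrow> rch {u, w2} z' y \<and> rch {z', w2} x u"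
    using ex_last_cut[OF w2(2)] zw2 by blast
  \<comment> \<open>The vertex \<open>w1\<close> precedes \<open>w2\<close> on \<open>S\<close>, so
    \<open>no_double_before\<close> excludes \<open>z\<close> as the last cut vertex for
    \<open>w2\<close>.\<close>
  have z'z: "z' \<noteq> z"
  proof
    assume eq: "z' = z"
    obtain z2 where z2: "(y, z2) \<in> E" "(z2, w2) \<in> E" "z2 \<noteq> z"
      using card_ge_avoid[of "{z}" "{u. (y, u) \<in> E \<and> (u, w2) \<in> E}"] Z4 by auto
    then have "rch {z2, w2} z y" using lz eq by blast
    then show False
      using no_double_before[OF zv(1) z2 _ w2(2), of w1 U0 U1 "U2 @ w3 # U3 @ w4 # U4"] S Sd D(1)
      by (simp add: Dbl_def W_def)
  qed
  have "good z' w2" using z' w2 Z4 lz by (auto simp: good_def)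
  \<comment> \<open>The cut changes in two stages, from \<open>{z, v}\<close> to
    \<open>{z, w2}\<close> to \<open>{z', w2}\<close>. At neither stage is a newly forbidden vertex
    reachable, and in the end \<open>z\<close> becomes reachable.\<close>
  moreover have "{u. rch {z, v} x u} \<subset> {u. rch {z', w2} x u}"
  proof
    have nz: "\<not> rch F x t" if "t \<in> F" "t \<noteq> x" for F t using rch_target that by blast
    have nw2: "\<not> rch {z, v} x w2"
    proof
      assume r: "rch {z, v} x w2"
      have "is_walk E ((U0 @ w1 # U1) @ w2 # U2 @ w3 # U3 @ w4 # U4)" using S Sd by simp
      then have "is_walk E (w2 # U2 @ w3 # U3 @ w4 # U4)" by (rule is_walk_appendD2) simp
      then have "rch {z, v} w2 y"
        using S Sd vpos by (intro rch_walk[of "w2 # U2 @ w3 # U3 @ w4 # U4"]) auto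
      then show False using r rch_trans separates zv by blast
    qed
    have nz': "\<not> rch {z, w2} x z'"
    proof
      assume "rch {z, w2} x z'"
      moreover have "rch {z, w2} z' y" using lz zw2 z'z by blast
      ultimately show False using rch_trans separates zw2 w2 by blast
    qed
    show "{u. rch {z, v} x u} \<subseteq> {u. rch {z', w2} x u}"
    proof clarify
      fix u assume "rch {z, v} x u"
      then have "rch {z, w2} x u" by (rule rch_change) (use nz nw2 zV in auto)
      then show "rch {z', w2} x u" by (rule rch_change) (use nz nz' w2V in auto)
    qed
    show "{u. rch {z, v} x u} \<noteq> {u. rch {z', w2} x u}"
      using lz zw2 z'z nz[of z "{z, v}"] zV by blast
  qed
  ultimately show thesis using that by blast
qed

text \<open>Three such vertices would yield a \<open>good\<close> pair. One with the largest set
  reachable from \<open>x\<close> contradicts \<open>good_ascent\<close>.\<close>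

lemma few_two_step:
  assumes "(v, x) \<in> E"
  shows "card {u. (y, u) \<in> E \<and> (u, v) \<in> E} \<le> 2"
proof (rule ccontr)
  assume c: "\<not> ?thesis"
  then have "{u. (y, u) \<in> E \<and> (u, v) \<in> E} \<noteq> {}" by (metis card.empty zero_le)
  then have "\<exists>u. (y, u) \<in> E \<and> (u, v) \<in> E" by blast
  then obtain z where z: "(y, z) \<in> E" "(z, v) \<in> E"
    "\<And>u. (y, u) \<in> E \<Longrightarrow> (u, v) \<in> E \<Longrightarrow> u \<noteq> z \<Longrightarrow> rch {u, v} z y \<and> rch {z, v} x u"
    by (rule ex_last_cut[OF assms]) blast
  have "3 \<le> card {u. (y, u) \<in> E \<and> (u, v) \<in> E}" using c by linarith
  then have gzv: "good z v" using z assms unfolding good_def by blast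
  define f where "f = (\<lambda>(z, v). card {u. rch {z, v} x u})"
  have fV: "finite {u. rch {z, v} x u}" "f (z, v) < card V + 1" for z v
  proof -
    have "{u. rch {z, v} x u} \<subseteq> V" using rch_target xV by blast
    then show "finite {u. rch {z, v} x u}" "f (z, v) < card V + 1"
      using fin finite_subset card_mono by (auto simp: f_def less_Suc_eq_le)
  qed
  have "\<exists>p. (case p of (z, v) \<Rightarrow> good z v) \<and> (\<forall>q. (case q of (z, v) \<Rightarrow> good z v) \<longrightarrow> f q \<le> f p)"
    using gzv fV by (intro ex_has_greatest_nat[of _ "(z, v)" f "card V + 1"]) auto
  then obtain z v where g: "good z v" and max: "\<And>z' v'. good z' v' \<Longrightarrow> f (z', v') \<le> f (z, v)"
    by auto
  obtain z' v' where g': "good z' v'" "{u. rch {z, v} x u} \<subset> {u. rch {z', v'} x u}"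
    using good_ascent[OF g] by blast
  then have "f (z, v) < f (z', v')" unfolding f_def using fV by (auto intro: psubset_card_mono)
  then show False using max[OF g'(1)] by simp
qed

text \<open>Here \<open>e\<close> and \<open>y\<close> are non-adjacent; of the five given by
  \<open>two_step_count\<close>, at most two are routes from \<open>y\<close> to
  \<open>e\<close>.\<close>

lemma many_exits:
  assumes e: "(e, x) \<in> E" "(e, y) \<notin> E"
  shows "3 \<le> card {u. (e, u) \<in> E \<and> (u, y) \<in> E}"
proof -
  have "e \<in> V" "e \<noteq> x" "e \<noteq> y" using e arcD xy_arc by blast+
  moreover have "(y, e) \<notin> E" using no_common_neighbour e by blast
  ultimately have "5 \<le> card {w. (y, w) \<in> E \<and> (w, e) \<in> E \<and> ((w, y) \<in> E \<or> (e, w) \<in> E)}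
      + card {w. (e, w) \<in> E \<and> (w, y) \<in> E}"
    using e by (intro two_step_count yV) (auto simp: nonadj_def doubleton_eq_iff)
  moreover have "card {w. (y, w) \<in> E \<and> (w, e) \<in> E \<and> ((w, y) \<in> E \<or> (e, w) \<in> E)}
      \<le> card {u. (y, u) \<in> E \<and> (u, e) \<in> E}"
    using finite_succ(1)[of y] by (intro card_mono) auto
  ultimately show ?thesis using few_two_step[OF e(1)] by simp
qed

lemma many_entries:
  assumes "(x, s) \<in> E" "(y, s) \<notin> E"
  shows "3 \<le> card {u. (y, u) \<in> E \<and> (u, s) \<in> E}"
proof -
  have "3 \<le> card {u. (s, u) \<in> E\<inverse> \<and> (u, y) \<in> E\<inverse>}"
    using no_common_cycle.many_exits[OF reverse, of s] assms by blast
  then show ?thesis by (simp add: conj_commute)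
qed

text \<open>Such a \<open>v\<close> would have at least three routes \<open>v -> u -> y\<close> by
  \<open>many_exits\<close>, but at most two by the reversed \<open>few_two_step\<close>.\<close>

lemma no_digon:
  assumes "(x, v) \<in> E" "(v, x) \<in> E" shows False
proof -
  have "(v, y) \<notin> E" using no_common_cycle.no_common_neighbour[OF swap] assms by blast
  then have "3 \<le> card {u. (v, u) \<in> E \<and> (u, y) \<in> E}" using many_exits assms by blast
  moreover have "card {u. (y, u) \<in> E\<inverse> \<and> (u, v) \<in> E\<inverse>} \<le> 2"
    using no_common_cycle.few_two_step[OF reverse, of v] assms by blast
  ultimately show False by (simp add: conj_commute)
qed

text \<open>The connector is empty or a single vertex; three candidates leave one outside a set of
  two forbidden vertices.\<close>

lemma entry:
  assumes s: "(x, s) \<in> E \<or> (y, s) \<in> E" and F: "finite F" "card F \<le> 2"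
  obtains \<alpha> where "set \<alpha> \<subseteq> {u. (y, u) \<in> E} - F" "distinct \<alpha>" "length \<alpha> \<le> 1" "s \<notin> set \<alpha>"
    "is_walk E ((y # \<alpha>) @ [s])"
proof (cases "(y, s) \<in> E")
  case True
  then show thesis using that[of "[]"] by (simp add: is_walk_Cons)
next
  case False
  then have "3 \<le> card {u. (y, u) \<in> E \<and> (u, s) \<in> E}" using many_entries s by blast
  then obtain u where "(y, u) \<in> E" "(u, s) \<in> E" "u \<notin> F"
    using card_ge_avoid[OF F(1), of "{u. (y, u) \<in> E \<and> (u, s) \<in> E}"] F(2) by auto
  then show thesis using that[of "[u]"] arcD[of u s] by (auto simp: is_walk_Cons)
qed

lemma exit:
  assumes e: "(e, x) \<in> E \<or> (e, y) \<in> E" and F: "finite F" "card F \<le> 2"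
  obtains \<beta> where "set \<beta> \<subseteq> {u. (u, y) \<in> E} - F" "distinct \<beta>" "length \<beta> \<le> 1" "e \<notin> set \<beta>"
    "is_walk E ([e] @ \<beta>)" "(last ([e] @ \<beta>), y) \<in> E"
proof (cases "(e, y) \<in> E")
  case True
  then show thesis using that[of "[]"] by simp
next
  case False
  then have "3 \<le> card {u. (e, u) \<in> E \<and> (u, y) \<in> E}" using many_exits e by blast
  then obtain u where "(e, u) \<in> E" "(u, y) \<in> E" "u \<notin> F"
    using card_ge_avoid[OF F(1), of "{u. (e, u) \<in> E \<and> (u, y) \<in> E}"] F(2) by auto
  then show thesis using that[of "[u]"] arcD[of e u] by (auto simp: is_walk_Cons)
qed

text \<open>The cycle runs from \<open>x\<close> via \<alpha>, \<open>p\<close>, \<beta> to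
  \<open>y\<close> and back via \<alpha>', \<open>q\<close>, \<beta>'. The connectors lie in
  \<open>L\<close> or \<open>R\<close>, which the trimmed paths meet only at their ends, so only a
  few collisions have to be avoided.\<close>

lemma contradiction: False
proof -
  interpret swap: no_common_cycle V E y x by (rule swap)
  define L where "L = {u. (x, u) \<in> E \<or> (y, u) \<in> E}"
  define R where "R = {u. (u, x) \<in> E \<or> (u, y) \<in> E}"
  define H where "H = V - {x, y}"
  have LR: "L \<inter> R = {}"
    using no_common_neighbour swap.no_common_neighbour no_digon swap.no_digon
    by (auto simp: L_def R_def)
  have LH: "L \<subseteq> H" using arcD xy_arc by (auto simp: L_def H_def)
  \<comment> \<open>The inner part of a path from \<open>x\<close> to \<open>y\<close> that avoids
    \<open>s\<close>. For \<open>s\<close> outside \<open>H\<close> any path will do, since its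
    inner part stays in \<open>H\<close>.\<close>
  have conn: "\<exists>xs. connects (Restr E H) L R xs \<and> s \<notin> set xs" for s
  proof -
    obtain S where S: "is_walk E S" "distinct S" "hd S = x" "last S = y" "set S \<subseteq> V" "s \<in> H \<Longrightarrow> s \<notin> set S"
    proof (cases "s \<in> H")
      case True
      then show thesis using path_avoiding[of s] that by (auto simp: H_def)
    next
      case False
      then show thesis using strong_on_path[OF strong xV yV] that by auto
    qed
    have "S \<noteq> []" using S is_walk_not_Nil by blast
    then obtain S' where S': "S = x # S'" using S(3) by (cases S) auto
    have "S' \<noteq> []" using S S' xy_arc by auto
    then obtain mid where mid: "S = x # mid @ [y]"
      using S S' append_butlast_last_id[of S'] by (metis last_ConsR)
    have mne: "mid \<noteq> []" using S(1) mid xy_arc by (auto simp: is_walk_Cons)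
    have w: "is_walk E mid" "(x, hd mid) \<in> E" "(last mid, y) \<in> E"
      using S(1) mid mne by (auto simp: is_walk_Cons is_walk_append)
    have sub: "set mid \<subseteq> H" using S mid by (auto simp: H_def)
    have "is_walk (Restr E H) mid"
      using w(1) sub
    proof (induction mid)
      case (Cons a m)
      then show ?case by (cases m) (auto simp: is_walk_Cons)
    qed (simp add: is_walk_def)
    then have "connects (Restr E H) L R mid" using w by (auto simp: connects_def L_def R_def)
    moreover have "s \<notin> set mid" using S(6) mid sub by auto
    ultimately show ?thesis by blast
  qed
  have "finite (Restr E H)" using fin finite_subset[of "Restr E H" "V \<times> V"] EV by auto
  from two_disjoint_walks[OF this conn] obtain p0 q0 where
    pq0: "connects (Restr E H) L R p0" "connects (Restr E H) L R q0" "set p0 \<inter> set q0 = {}" by blast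
  obtain p where p: "connects (Restr E H) L R p" "distinct p" "set p \<subseteq> set p0"
    "set (tl p) \<inter> L = {}" "set (butlast p) \<inter> R = {}" using connects_trim[OF pq0(1) LR] by blast
  obtain q where q: "connects (Restr E H) L R q" "distinct q" "set q \<subseteq> set q0"
    "set (tl q) \<inter> L = {}" "set (butlast q) \<inter> R = {}" using connects_trim[OF pq0(2) LR] by blast
  have pq: "set p \<inter> set q = {}" using pq0(3) p(3) q(3) by auto
  have ends: "r \<noteq> [] \<and> set r \<subseteq> H \<and> is_walk E r \<and> hd r \<in> L \<and> last r \<in> R \<and>
      (\<forall>u\<in>set r. (u \<in> L \<longrightarrow> u = hd r) \<and> (u \<in> R \<longrightarrow> u = last r))"
    if "connects (Restr E H) L R r" "set (tl r) \<inter> L = {}" "set (butlast r) \<inter> R = {}" for r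
  proof -
    have r: "is_walk (Restr E H) r" "hd r \<in> L" "last r \<in> R" using that(1) by (auto simp: connects_def)
    have ne: "r \<noteq> []" using r is_walk_not_Nil by blast
    have "\<forall>u\<in>set r. u \<in> L \<longrightarrow> u = hd r" using that(2) ne by (cases r) auto
    moreover have "\<forall>u\<in>set r. u \<in> R \<longrightarrow> u = last r"
      using that(3) ne append_butlast_last_id[OF ne]
      by (metis (no_types, lifting) disjoint_iff in_set_conv_decomp rotate1.simps(2) set_ConsD set_rotate1)
    ultimately show ?thesis using is_walk_Restr_subset[OF r(1)] r LH ne by blast
  qed
  note pe = ends[OF p(1,4,5)] and qe = ends[OF q(1,4,5)]
  have sp: "(y, hd p) \<in> E \<or> (x, hd p) \<in> E" and sq: "(x, hd q) \<in> E \<or> (y, hd q) \<in> E"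
    and ep: "(last p, x) \<in> E \<or> (last p, y) \<in> E" and eq: "(last q, y) \<in> E \<or> (last q, x) \<in> E"
    using pe qe by (auto simp: L_def R_def)
  have c2: "card (insert a (set \<gamma>)) \<le> 2" "finite (insert a (set \<gamma>))"
    if "distinct \<gamma>" "length \<gamma> \<le> 1" for a :: 'a and \<gamma>
    using that card_insert_le_m1[of 2 "set \<gamma>" a] by (simp_all add: distinct_card)
  have c1: "card {a} \<le> 2" "finite {a}" for a :: 'a by simp_all
  \<comment> \<open>The connectors are chosen in turn: \<alpha> has to avoid the start of
    \<open>q\<close>, and \<alpha>' the start of \<open>p\<close> and the vertex of \<alpha>, if
    any, which is at most two vertices. The exits are chosen likewise.\<close>
  obtain \<alpha> where \<alpha>: "set \<alpha> \<subseteq> {u. (x, u) \<in> E} - {hd q}" "distinct \<alpha>" "length \<alpha> \<le> 1" "hd p \<notin> set \<alpha>"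
    "is_walk E ((x # \<alpha>) @ [hd p])" by (rule swap.entry[OF sp c1(2,1)])
  obtain \<alpha>' where \<alpha>': "set \<alpha>' \<subseteq> {u. (y, u) \<in> E} - insert (hd p) (set \<alpha>)" "distinct \<alpha>'"
    "length \<alpha>' \<le> 1" "hd q \<notin> set \<alpha>'" "is_walk E ((y # \<alpha>') @ [hd q])"
    by (rule entry[OF sq c2(2,1)[OF \<alpha>(2,3)]])
  obtain \<beta> where \<beta>: "set \<beta> \<subseteq> {u. (u, y) \<in> E} - {last q}" "distinct \<beta>" "length \<beta> \<le> 1" "last p \<notin> set \<beta>"
    "is_walk E ([last p] @ \<beta>)" "(last ([last p] @ \<beta>), y) \<in> E"
    by (rule exit[OF ep c1(2,1)])
  obtain \<beta>' where \<beta>': "set \<beta>' \<subseteq> {u. (u, x) \<in> E} - insert (last p) (set \<beta>)" "distinct \<beta>'"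
    "length \<beta>' \<le> 1" "last q \<notin> set \<beta>'" "is_walk E ([last q] @ \<beta>')" "(last ([last q] @ \<beta>'), x) \<in> E"
    by (rule swap.exit[OF eq c2(2,1)[OF \<beta>(2,3)]])
  have walk: "is_walk E ((a # \<gamma>) @ r @ \<delta>)"
    if "r \<noteq> []" "is_walk E r" "is_walk E ((a # \<gamma>) @ [hd r])" "is_walk E ([last r] @ \<delta>)" for a \<gamma> r \<delta>
  proof -
    have "is_walk E (a # \<gamma>)" "(last (a # \<gamma>), hd r) \<in> E"
      using that(3) is_walk_append[of "a # \<gamma>" "[hd r]" E] by auto
    moreover have "is_walk E (r @ \<delta>)"
      using that is_walk_append[of "[last r]" \<delta> E] by (cases "\<delta> = []") (auto simp: is_walk_append)
    ultimately show ?thesis using that(1) is_walk_append[of "a # \<gamma>" "r @ \<delta>" E] by simp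
  qed
  define P where "P = (x # \<alpha>) @ p @ \<beta>"
  define Q where "Q = (y # \<alpha>') @ q @ \<beta>'"
  have LL: "set \<alpha> \<subseteq> L" "set \<alpha>' \<subseteq> L" "set \<beta> \<subseteq> R" "set \<beta>' \<subseteq> R"
    using \<alpha>(1) \<alpha>'(1) \<beta>(1) \<beta>'(1) by (auto simp: L_def R_def)
  have RH: "R \<subseteq> H" using arcD xy_arc by (auto simp: R_def H_def)
  have xyn: "x \<notin> H" "y \<notin> H" by (auto simp: H_def)
  have meet: "set p \<inter> L \<subseteq> {hd p}" "set p \<inter> R \<subseteq> {last p}" "set q \<inter> L \<subseteq> {hd q}" "set q \<inter> R \<subseteq> {last q}"
    using pe qe by auto
  have pqH: "set p \<subseteq> H" "set q \<subseteq> H" using pe qe by auto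
  have dp: "set \<alpha> \<inter> set p = {}" "set p \<inter> set \<beta> = {}" "set \<alpha>' \<inter> set q = {}" "set q \<inter> set \<beta>' = {}"
    using LL meet \<alpha>(4) \<alpha>'(4) \<beta>(4) \<beta>'(4) by blast+
  have dab: "set \<alpha> \<inter> set \<beta> = {}" "set \<alpha>' \<inter> set \<beta>' = {}" "set \<alpha> \<inter> set \<beta>' = {}" "set \<alpha>' \<inter> set \<beta> = {}"
    using LL LR by blast+
  have av: "hd q \<notin> set \<alpha>" "hd p \<notin> set \<alpha>'" "last q \<notin> set \<beta>" "last p \<notin> set \<beta>'"
    using \<alpha>(1) \<alpha>'(1) \<beta>(1) \<beta>'(1) by auto
  have cr: "set \<alpha> \<inter> set q = {}" "set \<alpha>' \<inter> set p = {}" "set q \<inter> set \<beta> = {}" "set p \<inter> set \<beta>' = {}"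
    using LL meet av by blast+
  have ss: "set \<alpha> \<inter> set \<alpha>' = {}" "set \<beta> \<inter> set \<beta>' = {}" using \<alpha>'(1) \<beta>'(1) by auto
  have allH: "set \<alpha> \<union> set p \<union> set \<beta> \<subseteq> H" "set \<alpha>' \<union> set q \<union> set \<beta>' \<subseteq> H"
    using LL LH RH pqH by blast+
  have "is_walk E P" unfolding P_def by (rule walk) (use pe \<alpha>(5) \<beta>(5) in simp_all)
  moreover have "is_walk E Q" unfolding Q_def by (rule walk) (use qe \<alpha>'(5) \<beta>'(5) in simp_all)
  moreover have "distinct P" "distinct Q"
    using \<alpha>(2) \<alpha>'(2) \<beta>(2) \<beta>'(2) p(2) q(2) dp dab allH xyn by (auto simp: P_def Q_def)
  moreover have "set P \<inter> set Q = {}"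
  proof -
    have "(set \<alpha> \<union> set p \<union> set \<beta>) \<inter> (set \<alpha>' \<union> set q \<union> set \<beta>') = {}"
      using pq dab(3,4) cr ss by (simp add: Int_Un_distrib Int_Un_distrib2 Int_commute)
    moreover have "set P = insert x (set \<alpha> \<union> set p \<union> set \<beta>)" "set Q = insert y (set \<alpha>' \<union> set q \<union> set \<beta>')"
      by (auto simp: P_def Q_def)
    ultimately show ?thesis using allH xyn xy_arc(3) by auto
  qed
  moreover have "(last P, hd Q) \<in> E" "(last Q, hd P) \<in> E"
  proof -
    have "last P = last ([last p] @ \<beta>)" "last Q = last ([last q] @ \<beta>')" using pe qe by (auto simp: P_def Q_def)
    then show "(last P, hd Q) \<in> E" "(last Q, hd P) \<in> E" using \<beta>(6) \<beta>'(6) by (simp_all add: P_def Q_def)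
  qed
  ultimately have "is_cycle E (P @ Q)" by (rule is_cycle_close)
  then show False by (rule no_cycle) (auto simp: P_def Q_def)
qed

end

subsection \<open>Pancyclicity\<close>

lemma is_cycle_subset:
  assumes "is_cycle E C" "E \<subseteq> V \<times> V" shows "set C \<subseteq> V"
proof
  fix c assume "c \<in> set C"
  then obtain C1 C2 where "C = C1 @ c # C2" by (meson split_list)
  then have "is_cycle E (c # C2 @ C1)" using assms is_cycle_rotate[of E C1 "c # C2"] by simp
  then show "c \<in> V" using assms(2) by (cases "C2 @ C1") (auto simp: is_cycle_def is_walk_Cons)
qed

lemma all_cycle_lengths:
  assumes fin: "finite V" and EV: "E \<subseteq> V \<times> V" and irr: "irrefl E"
    and xV: "x \<in> V" and yV: "y \<in> V" and xy: "nonadj E x y" and V3: "3 \<le> card V"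
    and strong: "strong_on E V" and two_strong: "\<And>v. v \<in> V \<Longrightarrow> strong_on E (V - {v})"
    and deg: "\<And>u v. u \<in> V \<Longrightarrow> v \<in> V \<Longrightarrow> nonadj E u v \<Longrightarrow> {u, v} \<noteq> {x, y} \<Longrightarrow>
      2 * card V + 1 \<le> deg_into E V u + deg_into E V v"
    and m: "3 \<le> m" "m \<le> card V"
  shows "\<exists>C. is_cycle E C \<and> length C = m"
proof -
  have "\<exists>C. is_cycle E C \<and> x \<in> set C \<and> y \<in> set C"
  proof (rule ccontr)
    assume "\<not> ?thesis"
    then have "no_common_cycle V E x y"
      using assms(1-6) strong two_strong deg by unfold_locales blast+
    then show False by (rule no_common_cycle.contradiction)
  qed
  then obtain C0 where C0: "is_cycle E C0" "x \<in> set C0" "y \<in> set C0" by blast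
  have deg1: "2 * card V \<le> deg_into E V u + deg_into E V v + 1"
    if "u \<in> V" "v \<in> V" "nonadj E u v" "{u, v} \<noteq> {x, y}" for u v using deg[OF that] by simp
  obtain H where H: "is_cycle E H" "set C0 \<subseteq> set H" "set H \<subseteq> V" "V - set H \<subseteq> {x} \<or> V - set H \<subseteq> {y}"
    by (rule near_hamiltonian_cycle[OF fin irr strong C0(1) is_cycle_subset[OF C0(1) EV] deg1])
  \<comment> \<open>\<open>H\<close> contains \<open>x\<close> and \<open>y\<close>, so neither can
    be the vertex it misses.\<close>
  have "set H = V" using H C0 by blast
  then have lenH: "length H = card V" using H(1) distinct_card[of H] by (simp add: is_cycle_def)
  show ?thesis
  proof (cases "m = card V")
    case True
    then show ?thesis using H lenH by blast
  next
    case False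
    then have mV: "m \<le> card V - 1" using m by simp
    show ?thesis
    proof (cases "\<exists>u\<in>V. \<exists>v\<in>V. nonadj E u v \<and> {u, v} \<noteq> {x, y}")
      case True
      then obtain u v where "u \<in> V" "v \<in> V" "2 * card V + 1 \<le> deg_into E V u + deg_into E V v"
        using deg by blast
      then have "card V + 1 \<le> deg_into E V u \<or> card V + 1 \<le> deg_into E V v" by linarith
      then obtain w where w: "w \<in> V" "card V + 1 \<le> deg_into E V w"
        using \<open>u \<in> V\<close> \<open>v \<in> V\<close> by blast
      define A where "A = V - {w}"
      have finA: "finite A" and strA: "strong_on E A" using fin two_strong w by (auto simp: A_def)
      have cA: "card A = card V - 1" using w fin by (simp add: A_def)
      have "2 \<le> card A" using cA V3 by simp
      then obtain T where "T \<subseteq> A" "card T = 2" using obtain_subset_with_card_n[of 2 A] by auto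
      then obtain a b where ab: "a \<in> A" "b \<in> A" "a \<noteq> b" by (auto simp: card_2_iff)
      obtain C1 where C1: "is_cycle E C1" "set C1 \<subseteq> A" using strong_on_ex_cycle[OF strA ab] by blast
      have dA: "deg_into E V p \<le> deg_into E A p + 2" for p
      proof -
        have "deg_into E V p = deg_into E {w} p + deg_into E (V - {w}) p"
          using fin w by (intro deg_into_split) auto
        then show ?thesis using deg_into_le[of "{w}" E p] by (simp add: A_def)
      qed
      \<comment> \<open>Deleting \<open>w\<close> costs each degree at most 2, and
        \<open>2 * card V + 1 - 4\<close> equals \<open>2 * card A - 1\<close>.\<close>
      have degA: "2 * card A \<le> deg_into E A p + deg_into E A q + 1"
        if "p \<in> A" "q \<in> A" "nonadj E p q" "{p, q} \<noteq> {x, y}" for p q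
        using deg[of p q] that dA[of p] dA[of q] cA V3 by (simp add: A_def)
      obtain C where C: "is_cycle E C" "set C1 \<subseteq> set C" "set C \<subseteq> A"
        "A - set C \<subseteq> {x} \<or> A - set C \<subseteq> {y}"
        by (rule near_hamiltonian_cycle[OF finA irr strA C1 degA])
      from C(4) obtain t where t: "A - set C \<subseteq> {t}" by blast
      have lC: "length C = card (set C)" using C by (simp add: is_cycle_def distinct_card)
      have cC: "card (set C) + card (A - set C) = card A"
        using C(3) finA card_Diff_subset[of "set C" A] card_mono[of A "set C"] by simp
      have cAC: "card (A - set C) \<le> 1" using card_mono[OF _ t] by simp
      have wC: "w \<notin> set C" using C by (auto simp: A_def)
      have "deg_into E V w = deg_into E A w + deg_into E (V - A) w"
        using fin by (intro deg_into_split) (auto simp: A_def)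
      moreover have "deg_into E (V - A) w = 0"
        using irr by (intro deg_into_eq_0) (auto simp: A_def irrefl_def)
      moreover have "deg_into E A w = deg_into E (set C) w + deg_into E (A - set C) w"
        using finA C(3) by (intro deg_into_split) auto
      moreover have "deg_into E (A - set C) w \<le> 2 * card (A - set C)"
        using finA by (intro deg_into_le) auto
      ultimately have "length C + 1 \<le> deg_into E (set C) w" using w cA cC cAC lC by linarith
      then show ?thesis
        using cycle_all_lengths[OF C(1) wC, of m] m mV cA cC cAC lC by simp
    next
      case False
      \<comment> \<open>With \<open>{x, y}\<close> the only non-adjacent pair, deleting
        \<open>x\<close> leaves a strong semicomplete digraph.\<close>
      have semi: "(u, v) \<in> E \<or> (v, u) \<in> E" if "u \<in> V - {x}" "v \<in> V - {x}" "u \<noteq> v" for u v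
        using False that by (auto simp: nonadj_def doubleton_eq_iff)
      show ?thesis
        using semicomplete_pancyclic[OF _ two_strong[OF xV] irr semi m(1)] fin xV mV by simp
    qed
  qed
qed

section \<open>Transfer between digraphs and their arc relations\<close>

lemma (in digraph) total_degree_eq:
  "total_degree G w = deg_into (arcs_ends G) (verts G) w"
proof -
  have "bij_betw (head G) (out_arcs G w) {u \<in> verts G. (w, u) \<in> arcs_ends G}"
    unfolding bij_betw_def
  proof
    \<comment> \<open>Without parallel arcs, an arc leaving \<open>w\<close> is determined by its
      head.\<close>
    show "inj_on (head G) (out_arcs G w)"
      by (rule inj_onI) (auto intro!: no_multi_arcs simp: out_arcs_def arc_to_ends_def)
    show "head G ` out_arcs G w = {u \<in> verts G. (w, u) \<in> arcs_ends G}"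
      by (auto simp: out_arcs_def arcs_ends_conv)
  qed
  moreover have "bij_betw (tail G) (in_arcs G w) {u \<in> verts G. (u, w) \<in> arcs_ends G}"
    unfolding bij_betw_def
  proof
    show "inj_on (tail G) (in_arcs G w)"
      by (rule inj_onI) (auto intro!: no_multi_arcs simp: in_arcs_def arc_to_ends_def)
    show "tail G ` in_arcs G w = {u \<in> verts G. (u, w) \<in> arcs_ends G}"
      by (auto simp: in_arcs_def arcs_ends_conv)
  qed
  ultimately show ?thesis
    by (simp add: total_degree_def out_degree_def in_degree_def deg_into_def bij_betw_same_card)
qed

lemma (in wf_digraph) strong_on_arcs_ends:
  assumes "strongly_connected G" shows "strong_on (arcs_ends G) (verts G)"
proof -
  have "Restr (arcs_ends G) (verts G) = arcs_ends G" using adj_in_verts by auto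
  moreover have "(a, b) \<in> (arcs_ends G)\<^sup>*" if "a \<in> verts G" "b \<in> verts G" for a b
    using assms that reachable_rtranclI[of G a b] unfolding strongly_connected_def by blast
  ultimately show ?thesis by (simp add: strong_on_def)
qed

lemma (in wf_digraph) strong_on_del_vert:
  assumes "strongly_connected (del_vert v)" shows "strong_on (arcs_ends G) (verts G - {v})"
proof -
  have "strong_on (arcs_ends (del_vert v)) (verts G - {v})"
    using wf_digraph.strong_on_arcs_ends[OF wf_digraph_del_vert assms] by (simp add: verts_del_vert)
  moreover have "Restr (arcs_ends (del_vert v)) (verts G - {v}) \<subseteq> Restr (arcs_ends G) (verts G - {v})"
    by (auto simp: arcs_ends_conv del_vert_simps)
  ultimately show ?thesis unfolding strong_on_def using rtrancl_mono by blast
qed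

lemma (in wf_digraph) is_walk_imp_awalk:
  assumes "is_walk (arcs_ends G) (u # xs)" "u \<in> verts G"
  shows "\<exists>p. awalk u p (last (u # xs)) \<and> awalk_verts u p = u # xs"
  using assms
proof (induction xs arbitrary: u)
  case Nil
  then show ?case by (intro exI[of _ "[]"]) (simp add: awalk_Nil_iff)
next
  case (Cons v xs)
  then have uv: "(u, v) \<in> arcs_ends G" and w: "is_walk (arcs_ends G) (v # xs)"
    by (auto simp: is_walk_Cons)
  obtain e where e: "e \<in> arcs G" "tail G e = u" "head G e = v" using uv by (rule reachableE)
  have "v \<in> verts G" using uv adj_in_verts by blast
  then obtain p where "awalk v p (last (v # xs))" "awalk_verts v p = v # xs"
    using Cons.IH w by blast
  then show ?case using e by (intro exI[of _ "e # p"]) (auto simp: awalk_Cons_iff)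
qed

text \<open>Repeating the first vertex at the end gives a closed walk with as many arcs as
  \<open>C\<close> has vertices.\<close>

lemma (in wf_digraph) is_cycle_imp_cycle:
  assumes "is_cycle (arcs_ends G) C"
  shows "\<exists>p. cycle p \<and> length p = length C"
proof -
  obtain u xs where C: "C = u # xs" using assms by (cases C) (auto simp: is_cycle_def)
  have "is_walk (arcs_ends G) (C @ [u])" using assms C is_walk_append[of C "[u]"] by (simp add: is_cycle_def)
  moreover have "arcs_ends G \<subseteq> verts G \<times> verts G" using adj_in_verts by auto
  then have "u \<in> verts G" using is_cycle_subset[OF assms] C by auto
  ultimately obtain p where p: "awalk u p u" "awalk_verts u p = u # xs @ [u]"
    using is_walk_imp_awalk[of u "xs @ [u]"] C by auto
  have "length p = length C" using arg_cong[OF p(2), of length] C by (simp add: length_awalk_verts)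
  moreover have "distinct (tl (awalk_verts u p))" using p assms C by (auto simp: is_cycle_def)
  moreover have "p \<noteq> []" using p by auto
  ultimately show ?thesis using p(1) unfolding cycle_def by blast
qed

theorem theorem1p16:
  fixes D :: "('a, 'b) pre_digraph" and n :: nat
  assumes "digraph D"
    and "two_strong D"
    and "card (verts D) = n" and "n \<ge> 6"
    and "\<And>x y w z. nonadjacent_pair D x y \<Longrightarrow> nonadjacent_pair D w z \<Longrightarrow> {x, y} \<noteq> {w, z} \<Longrightarrow>
           total_degree D x + total_degree D y + total_degree D w + total_degree D z \<ge> 4 * n - 3"
    and "\<exists>x y. nonadjacent_pair D x y \<and> total_degree D x + total_degree D y \<le> 2 * n - 4"
  shows "pancyclic D"
proof -
  interpret digraph D by (rule assms(1))
  let ?E = "arcs_ends D" and ?V = "verts D"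
  obtain x y where xy: "nonadjacent_pair D x y" "total_degree D x + total_degree D y \<le> 2 * n - 4"
    using assms(6) by blast
  have na: "nonadjacent_pair D u v \<longleftrightarrow> u \<in> ?V \<and> v \<in> ?V \<and> nonadj ?E u v" for u v
    by (auto simp: nonadjacent_pair_def adjacent_def nonadj_def)
  have deg: "2 * card ?V + 1 \<le> deg_into ?E ?V u + deg_into ?E ?V v"
    if "u \<in> ?V" "v \<in> ?V" "nonadj ?E u v" "{u, v} \<noteq> {x, y}" for u v
  proof -
    \<comment> \<open>Subtracting the at most \<open>2 * n - 4\<close> of the pair \<open>x\<close>,
      \<open>y\<close> leaves at least \<open>2 * n + 1\<close> for any other pair.\<close>
    have "4 * n - 3 \<le> total_degree D u + total_degree D v + total_degree D x + total_degree D y"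
      using assms(5)[of u v x y] that xy na by blast
    then show ?thesis using xy(2) assms(3,4) by (simp add: total_degree_eq)
  qed
  have "\<exists>C. is_cycle ?E C \<and> length C = m" if m: "3 \<le> m" "m \<le> card ?V" for m
  proof (rule all_cycle_lengths)
    show "?E \<subseteq> ?V \<times> ?V" using adj_in_verts by auto
    show "irrefl ?E" using adj_not_same by (auto simp: irrefl_def)
    show "x \<in> ?V" "y \<in> ?V" "nonadj ?E x y" using xy na by auto
    show "strong_on ?E ?V" using strong_on_arcs_ends assms(2) by (simp add: two_strong_def)
    show "strong_on ?E (?V - {v})" if "v \<in> ?V" for v
      using strong_on_del_vert that assms(2) by (simp add: two_strong_def)
  qed (use m deg assms(3,4) in simp_all)
  then show ?thesis using is_cycle_imp_cycle unfolding pancyclic_def by metis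
qed

end
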